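(* Let $p$ be an odd prime, let $q$ and $n$ be powers of $p$, and let $G=\mathrm{Gal}(\mathbb{F}_{q^n}/\mathbb{F}_q)$, generated by the Frobenius $\phi:x\mapsto x^q$. The solutions $v\in\mathbb{F}_q[G]$ to the equation $v\overline{v}=1$ are exactly the sums $v=\sum_{i=0}^{n-1}v_i(\phi-1)^i$ with $v_0=\pm1$ and, for $1\le i\le\frac{n-1}{2}$, $v_{2i-1}$ is any element of $\mathbb{F}_q$ and $v_{2i}\in\mathbb{F}_q$ is such that $$\sum_{j=1}^{2i}\sum_{k=0}^{j}(-1)^k\binom{n-k}{2i-j}v_kv_{j-k}=0.$$
   Context: $G$ is cyclic of order $n$. Conjugation $u\mapsto\overline{u}$ on the group algebra $\mathbb{F}_q[G]$ is the $\mathbb{F}_q$-algebra automorphism induced by $g\mapsto g^{-1}$ for $g\in G$. The binomial coefficients are viewed as elements of $\mathbb{F}_p\subseteq\mathbb{F}_q$. *)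

theory Defs
  imports "HOL-Algebra.Bij" "HOL-Algebra.Module" "HOL-Algebra.Subrings" "HOL-Computational_Algebra.Primes"
begin

text \<open>The automorphisms of a field \<open>L\<close> that fix \<open>K\<close> pointwise, under composition.
  As for \<^const>\<open>AutoGroup\<close>, they are extensional functions on the carrier of \<open>L\<close>.\<close>

definition galois_group :: "'a set \<Rightarrow> ('a, 'm) ring_scheme \<Rightarrow> ('a \<Rightarrow> 'a) monoid" where
  "galois_group K L = BijGroup (carrier L)
     \<lparr>carrier := {\<sigma> \<in> Bij (carrier L). \<sigma> \<in> ring_hom L L \<and> (\<forall>x\<in>K. \<sigma> x = x)}\<rparr>"

definition frobenius :: "nat \<Rightarrow> ('a, 'm) ring_scheme \<Rightarrow> 'a \<Rightarrow> 'a" where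
  "frobenius q L = (\<lambda>x\<in>carrier L. x [^]\<^bsub>L\<^esub> q)"

text \<open>The formal sum of the \<open>u\<^sub>g g\<close> is represented by its finitely supported coefficient
  function \<open>u\<close>. In the product, the sum is restricted to the support of \<open>u\<close> because
  \<^const>\<open>finsum\<close> gives zero on infinite index sets.\<close>

definition group_algebra ::
    "('r, 'm) ring_scheme \<Rightarrow> ('g, 'k) monoid_scheme \<Rightarrow> ('r, 'g \<Rightarrow> 'r) module" where
  "group_algebra R G =
    \<lparr>carrier = {u \<in> carrier G \<rightarrow>\<^sub>E carrier R. finite {g \<in> carrier G. u g \<noteq> \<zero>\<^bsub>R\<^esub>}},
     monoid.mult = \<lambda>u w. \<lambda>g\<in>carrier G.
       (\<Oplus>\<^bsub>R\<^esub>h\<in>{h \<in> carrier G. u h \<noteq> \<zero>\<^bsub>R\<^esub>}. u h \<otimes>\<^bsub>R\<^esub> w (inv\<^bsub>G\<^esub> h \<otimes>\<^bsub>G\<^esub> g)),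
     one = \<lambda>g\<in>carrier G. if g = \<one>\<^bsub>G\<^esub> then \<one>\<^bsub>R\<^esub> else \<zero>\<^bsub>R\<^esub>,
     ring.zero = \<lambda>g\<in>carrier G. \<zero>\<^bsub>R\<^esub>,
     add = \<lambda>u w. \<lambda>g\<in>carrier G. u g \<oplus>\<^bsub>R\<^esub> w g,
     module.smult = \<lambda>c u. \<lambda>g\<in>carrier G. c \<otimes>\<^bsub>R\<^esub> u g\<rparr>"

definition group_element ::
    "('r, 'm) ring_scheme \<Rightarrow> ('g, 'k) monoid_scheme \<Rightarrow> 'g \<Rightarrow> 'g \<Rightarrow> 'r" where
  "group_element R G g = (\<lambda>h\<in>carrier G. if h = g then \<one>\<^bsub>R\<^esub> else \<zero>\<^bsub>R\<^esub>)"

text \<open>The linear extension of inversion sends the sum of the \<open>u\<^sub>g g\<close> to the sum of the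
  \<open>u\<^sub>g g\<^sup>-\<^sup>1\<close>, whose coefficient at \<open>g\<close> is the coefficient of \<open>u\<close> at the inverse of \<open>g\<close>.\<close>

definition conjugation :: "('g, 'k) monoid_scheme \<Rightarrow> ('g \<Rightarrow> 'r) \<Rightarrow> 'g \<Rightarrow> 'r" where
  "conjugation G u = (\<lambda>g\<in>carrier G. u (inv\<^bsub>G\<^esub> g))"

lemma conjugation_group_element:
  assumes "group G" and "g \<in> carrier G"
  shows "conjugation G (group_element R G g) = group_element R G (inv\<^bsub>G\<^esub> g)"
proof -
  interpret group G by fact
  show ?thesis
    using assms(2) by (auto simp: conjugation_def group_element_def fun_eq_iff restrict_def)
qed

end

theory Submission
  imports Defs "HOL-Algebra.Multiplicative_Group"
begin

text \<open>
  Put \<open>x = \<phi> - 1\<close>. In characteristic \<open>p\<close> we have \<open>x\<^sup>n = \<phi>\<^sup>n - 1 = 0\<close>, and \<open>1, x, \<dots>, x\<^sup>n\<^sup>-\<^sup>1\<close>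
  is a basis of the group algebra. The conjugate of \<open>x\<close> is \<open>- x \<phi>\<^sup>-\<^sup>1\<close>, so the conjugate
  of \<open>x\<^sup>k\<close> is \<open>(-1)\<^sup>k x\<^sup>k (1 + x)\<^sup>n\<^sup>-\<^sup>k\<close>. Expanding the product of \<open>v\<close> with its conjugate in powers of \<open>x\<close>,
  the coefficient of \<open>x\<^sup>i\<close> is the double sum of the statement, except that \<open>j\<close> starts
  at \<open>0\<close>; for \<open>0 < i < n\<close> the term with \<open>j = 0\<close> vanishes because \<open>p\<close> divides \<open>n choose i\<close>.
  Only even \<open>i\<close> give a condition: the product is fixed by conjugation, and conjugation
  multiplies the lowest nonconstant term, of degree \<open>i\<close> say, by \<open>(-1)\<^sup>i\<close>.

  That \<open>\<phi>\<close> generates the Galois group, of order \<open>n\<close>, is proved by counting: a generator \<open>a\<close>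
  of the multiplicative group of the large field is a root of a nonzero polynomial of degree at most \<open>n\<close>
  over the small field, an automorphism is determined by its value at \<open>a\<close>, and this value is again a root.
\<close>

section \<open>Sums and powers in commutative rings\<close>

lemma (in abelian_monoid) finsum_swap:
  assumes "finite A" "finite B" "\<And>i j. i \<in> A \<Longrightarrow> j \<in> B \<Longrightarrow> f i j \<in> carrier G"
  shows "(\<Oplus>i\<in>A. \<Oplus>j\<in>B. f i j) = (\<Oplus>j\<in>B. \<Oplus>i\<in>A. f i j)"
  using assms(1,3)
proof (induction A)
  case empty
  then show ?case by simp
next
  case (insert a A)
  have "(\<Oplus>j\<in>B. \<Oplus>i\<in>insert a A. f i j) = (\<Oplus>j\<in>B. f a j \<oplus> (\<Oplus>i\<in>A. f i j))"
    using insert.prems insert.hyps by (intro finsum_cong') (auto intro!: finsum_insert)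
  also have "\<dots> = (\<Oplus>j\<in>B. f a j) \<oplus> (\<Oplus>j\<in>B. \<Oplus>i\<in>A. f i j)"
    using insert.prems insert.hyps by (intro finsum_addf) auto
  finally show ?case
    using insert by (subst finsum_insert) auto
qed

section \<open>The binomial theorem and Frobenius maps in characteristic \<open>p\<close>\<close>

lemma (in cring) binomial_ring:
  assumes x: "x \<in> carrier R" and y: "y \<in> carrier R"
  shows "(x \<oplus> y) [^] (k::nat) = (\<Oplus>i\<in>{..k}. [(k choose i)] \<cdot> (x [^] i \<otimes> y [^] (k - i)))"
proof (induction k)
  case 0
  show ?case by simp
next
  case (Suc k)
  let ?t = "\<lambda>i. x [^] i \<otimes> y [^] (Suc k - i)"
  have t: "?t i \<in> carrier R" for i
    using x y by simp
  let ?S = "\<Oplus>i\<in>{..k}. [(k choose i)] \<cdot> (x [^] i \<otimes> y [^] (k - i))"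
  have "(x \<oplus> y) [^] Suc k = ?S \<otimes> x \<oplus> ?S \<otimes> y"
    using x y by (simp add: Suc.IH r_distr)
  also have "?S \<otimes> x = (\<Oplus>i\<in>{..k}. [(k choose i)] \<cdot> ?t (Suc i))"
    using x y
    by (subst finsum_ldistr) (auto intro!: finsum_cong' simp: add_pow_ldistr add_pow_rdistr m_ac)
  \<comment> \<open>Both sums are brought to the range \<open>{..Suc k}\<close> so that Pascal's
    rule applies termwise: this one is shifted by one and gets a zero at \<open>i = 0\<close>, the
    other gains a top term, where \<open>k choose Suc k\<close> is zero.\<close>
  also have "\<dots> = (\<Oplus>i\<in>{..Suc k}. if i = 0 then \<zero> else [(k choose (i - 1))] \<cdot> ?t i)"
    using x y by (subst finsum_Suc2) (auto intro!: finsum_cong')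
  also have "?S \<otimes> y = (\<Oplus>i\<in>{..k}. [(k choose i)] \<cdot> ?t i)"
    using x y
    by (subst finsum_ldistr)
      (auto intro!: finsum_cong' simp: add_pow_ldistr m_assoc Suc_diff_le)
  also have "\<dots> = (\<Oplus>i\<in>{..Suc k}. [(k choose i)] \<cdot> ?t i)"
    using t x y by (subst finsum_Suc) (auto simp: binomial_eq_0)
  also have "(\<Oplus>i\<in>{..Suc k}. if i = 0 then \<zero> else [(k choose (i - 1))] \<cdot> ?t i) \<oplus> \<dots> =
      (\<Oplus>i\<in>{..Suc k}. (if i = 0 then \<zero> else [(k choose (i - 1))] \<cdot> ?t i) \<oplus> [(k choose i)] \<cdot> ?t i)"
    using t by (intro finsum_addf[symmetric]) auto
  also have "\<dots> = (\<Oplus>i\<in>{..Suc k}. [(Suc k choose i)] \<cdot> ?t i)"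
  proof (rule finsum_cong')
    fix i
    show "(if i = 0 then \<zero> else [(k choose (i - 1))] \<cdot> ?t i) \<oplus> [(k choose i)] \<cdot> ?t i =
        [(Suc k choose i)] \<cdot> ?t i"
      using t[of i] by (cases i) (auto simp: add.nat_pow_mult)
  qed (use t in auto)
  finally show ?case .
qed

text \<open>The multiple \<open>[p] \<cdot> x\<close> is the product of
  \<open>[p] \<cdot> \<one>\<close> with \<open>x\<close>, hence zero. This discards binomial
  coefficients divisible by \<open>p\<close>.\<close>

lemma (in cring) add_pow_multiple_eq_zero:
  assumes "[(p::nat)] \<cdot> \<one> = \<zero>" and "p dvd k" and x: "x \<in> carrier R"
  shows "[k] \<cdot> x = \<zero>"
proof -
  obtain l where "k = l * p"
    using assms(2) by (auto simp: dvd_def mult.commute)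
  have "[p] \<cdot> x = [p] \<cdot> \<one> \<otimes> x"
    using x by (simp add: add_pow_ldistr)
  then have "[p] \<cdot> x = \<zero>"
    using assms by simp
  then show ?thesis
    using x by (simp add: \<open>k = l * p\<close> add.nat_pow_pow[symmetric] mult.commute[of l])
qed

text \<open>The prime \<open>p\<close> divides all inner binomial coefficients, so only the two end
  terms of the expansion survive.\<close>

lemma (in cring) frobenius_add:
  assumes p: "prime (p::nat)" "[p] \<cdot> \<one> = \<zero>" and x: "x \<in> carrier R" and y: "y \<in> carrier R"
  shows "(x \<oplus> y) [^] p = x [^] p \<oplus> y [^] p"
proof -
  let ?f = "\<lambda>i. [(p choose i)] \<cdot> (x [^] i \<otimes> y [^] (p - i))"
  have p0: "p \<noteq> 0" using p(1) by auto
  have f: "?f i \<in> carrier R" for i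
    using x y by simp
  have z: "?f i = \<zero>" if "i \<noteq> 0" "i \<noteq> p" "i \<le> p" for i
    using that p x y by (intro add_pow_multiple_eq_zero[OF p(2)]) (auto intro!: dvd_choose_prime)
  have "(x \<oplus> y) [^] p = (\<Oplus>i\<in>{..p}. ?f i)"
    by (rule binomial_ring[OF x y])
  also have "\<dots> = (\<Oplus>i\<in>{0, p}. ?f i)"
    using f z by (intro add.finprod_mono_neutral_cong_right) auto
  also have "\<dots> = y [^] p \<oplus> x [^] p"
    using p0 x y by (subst finsum_insert) auto
  finally show ?thesis
    using x y by (simp add: a_comm)
qed

lemma (in cring) frobenius_power_add:
  assumes p: "prime (p::nat)" "[p] \<cdot> \<one> = \<zero>" and x: "x \<in> carrier R" and y: "y \<in> carrier R"
  shows "(x \<oplus> y) [^] (p ^ m) = x [^] (p ^ m) \<oplus> y [^] (p ^ m)"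
proof (induction m)
  case 0
  then show ?case using x y by simp
next
  case (Suc m)
  have "z [^] (p ^ Suc m) = (z [^] (p ^ m)) [^] p" if "z \<in> carrier R" for z
    using that by (simp add: nat_pow_pow mult.commute)
  then show ?case
    using x y Suc frobenius_add[OF p] by simp
qed

text \<open>By absorption, \<open>p ^ m\<close> divides \<open>k * (p ^ m choose k)\<close>. If
  \<open>p\<close> did not divide the binomial coefficient, \<open>p ^ m\<close> would divide
  \<open>k\<close>, which is positive and smaller.\<close>

lemma prime_dvd_prime_power_choose:
  assumes "prime (p::nat)" "0 < k" "k < p ^ m"
  shows "p dvd (p ^ m choose k)"
proof -
  have "k * (p ^ m choose k) = p ^ m * ((p ^ m - 1) choose (k - 1))"
    using assms by (simp add: times_binomial_minus1_eq)
  then have *: "p ^ m dvd k * (p ^ m choose k)"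
    by simp
  show ?thesis
  proof (rule ccontr)
    assume "\<not> p dvd (p ^ m choose k)"
    then have "coprime (p ^ m) (p ^ m choose k)"
      using assms(1) by (simp add: prime_imp_coprime)
    then have "p ^ m dvd k"
      using * by (metis coprime_dvd_mult_left_iff)
    then show False
      using assms by (auto dest: dvd_imp_le)
  qed
qed

section \<open>Linear combinations in modules and algebras; powers of a nilpotent element\<close>

lemma (in module) add_pow_smult:
  assumes "a \<in> carrier R" "u \<in> carrier M"
  shows "([(k::nat)] \<cdot>\<^bsub>R\<^esub> a) \<odot>\<^bsub>M\<^esub> u = [k] \<cdot>\<^bsub>M\<^esub> (a \<odot>\<^bsub>M\<^esub> u)"
  using assms by (induction k) (auto simp: smult_l_distr)

lemma (in module) smult_finsum_left:
  assumes "finite I" "\<And>i. i \<in> I \<Longrightarrow> a i \<in> carrier R" "u \<in> carrier M"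
  shows "(\<Oplus>\<^bsub>R\<^esub>i\<in>I. a i) \<odot>\<^bsub>M\<^esub> u = (\<Oplus>\<^bsub>M\<^esub>i\<in>I. a i \<odot>\<^bsub>M\<^esub> u)"
  using assms(1,2)
proof (induction I)
  case (insert i I)
  then show ?case
    using assms(3) by (simp add: Pi_def smult_l_distr)
qed (use assms(3) in simp)

lemma (in module) smult_finsum_right:
  assumes "finite I" "\<And>i. i \<in> I \<Longrightarrow> u i \<in> carrier M" "a \<in> carrier R"
  shows "a \<odot>\<^bsub>M\<^esub> (\<Oplus>\<^bsub>M\<^esub>i\<in>I. u i) = (\<Oplus>\<^bsub>M\<^esub>i\<in>I. a \<odot>\<^bsub>M\<^esub> u i)"
  using assms(1,2)
proof (induction I)
  case (insert i I)
  then show ?case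
    using assms(3) by (simp add: Pi_def smult_r_distr)
qed (use assms(3) in simp)

lemma (in algebra) smult_mult_smult:
  assumes "a \<in> carrier R" "b \<in> carrier R" "u \<in> carrier M" "w \<in> carrier M"
  shows "(a \<odot>\<^bsub>M\<^esub> u) \<otimes>\<^bsub>M\<^esub> (b \<odot>\<^bsub>M\<^esub> w) = (a \<otimes>\<^bsub>R\<^esub> b) \<odot>\<^bsub>M\<^esub> (u \<otimes>\<^bsub>M\<^esub> w)"
proof -
  have "u \<otimes>\<^bsub>M\<^esub> (b \<odot>\<^bsub>M\<^esub> w) = b \<odot>\<^bsub>M\<^esub> (u \<otimes>\<^bsub>M\<^esub> w)"
    using assms M_cring by (metis cring.cring_simprules(14) smult_assoc2 smult_closed)
  then show ?thesis
    using assms by (simp add: smult_assoc2 smult_assoc1)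
qed

text \<open>A truncated Cauchy product: terms of degree at least \<open>n\<close> vanish by
  nilpotency. The coefficients \<open>H i j\<close> are arbitrary ring elements, so they may contain
  powers of a group generator.\<close>

lemma (in cring) finsum_powers_collect:
  assumes x: "x \<in> carrier R" and nil: "x [^] (n::nat) = \<zero>"
    and H: "\<And>i j. i < n \<Longrightarrow> j < n \<Longrightarrow> H i j \<in> carrier R"
  shows "(\<Oplus>i\<in>{..<n}. \<Oplus>j\<in>{..<n}. H i j \<otimes> x [^] (i + j)) =
    (\<Oplus>k\<in>{..<n}. (\<Oplus>i\<in>{..k}. H i (k - i)) \<otimes> x [^] k)"
proof -
  have nil': "x [^] k = \<zero>" if "k \<ge> n" for k
    using that x nil nat_pow_mult[OF x, of n "k - n"] by simp
  \<comment> \<open>For fixed \<open>i\<close>, put \<open>k = i + j\<close>. Zeros for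
    \<open>k < i\<close> make the range independent of \<open>i\<close>, so that the two sums can be
    exchanged.\<close>
  have shift: "(\<Oplus>j\<in>{..<n}. H i j \<otimes> x [^] (i + j)) =
      (\<Oplus>k\<in>{..<n}. if i \<le> k then H i (k - i) \<otimes> x [^] k else \<zero>)" if i: "i < n" for i
  proof -
    have "(\<Oplus>j\<in>{..<n}. H i j \<otimes> x [^] (i + j)) = (\<Oplus>j\<in>{..<n-i}. H i j \<otimes> x [^] (i + j))"
      using i H x by (intro add.finprod_mono_neutral_cong_right) (auto simp: nil')
    also have "\<dots> = (\<Oplus>k\<in>(+) i ` {..<n-i}. H i (k - i) \<otimes> x [^] k)"
      using i H x by (subst finsum_reindex) auto
    also have "\<dots> = (\<Oplus>k\<in>{..<n}. if i \<le> k then H i (k - i) \<otimes> x [^] k else \<zero>)"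
    proof (rule add.finprod_mono_neutral_cong_left)
      fix k assume k: "k \<in> {..<n} - (+) i ` {..<n-i}"
      have "\<not> i \<le> k"
      proof
        assume "i \<le> k"
        then have "k = i + (k - i)" "k - i \<in> {..<n-i}"
          using k by auto
        then show False
          using k by blast
      qed
      then show "(if i \<le> k then H i (k - i) \<otimes> x [^] k else \<zero>) = \<zero>"
        by simp
    qed (use i H x in auto)
    finally show ?thesis .
  qed
  have "(\<Oplus>i\<in>{..<n}. \<Oplus>j\<in>{..<n}. H i j \<otimes> x [^] (i + j)) =
      (\<Oplus>i\<in>{..<n}. \<Oplus>k\<in>{..<n}. if i \<le> k then H i (k - i) \<otimes> x [^] k else \<zero>)"
    by (rule finsum_cong') (use H x in \<open>auto simp: shift\<close>)
  also have "\<dots> = (\<Oplus>k\<in>{..<n}. \<Oplus>i\<in>{..<n}. if i \<le> k then H i (k - i) \<otimes> x [^] k else \<zero>)"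
    using H x by (intro finsum_swap) auto
  also have "\<dots> = (\<Oplus>k\<in>{..<n}. (\<Oplus>i\<in>{..k}. H i (k - i)) \<otimes> x [^] k)"
  proof (rule finsum_cong')
    fix k assume k: "k \<in> {..<n}"
    have "(\<Oplus>i\<in>{..<n}. if i \<le> k then H i (k - i) \<otimes> x [^] k else \<zero>) =
        (\<Oplus>i\<in>{..k}. H i (k - i) \<otimes> x [^] k)"
      using k H x by (intro add.finprod_mono_neutral_cong_right) auto
    also have "\<dots> = (\<Oplus>i\<in>{..k}. H i (k - i)) \<otimes> x [^] k"
      using k H x by (intro finsum_ldistr[symmetric]) auto
    finally show "(\<Oplus>i\<in>{..<n}. if i \<le> k then H i (k - i) \<otimes> x [^] k else \<zero>) =
        (\<Oplus>i\<in>{..k}. H i (k - i)) \<otimes> x [^] k" .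
  qed (use H x in auto)
  finally show ?thesis .
qed

lemma (in ring_hom_cring) hom_nat_pow:
  "x \<in> carrier R \<Longrightarrow> h (x [^] (k::nat)) = h x [^]\<^bsub>S\<^esub> k"
  by (induction k) auto

section \<open>Group algebras of finite abelian groups\<close>

lemma carrier_group_algebra:
  "finite (carrier G) \<Longrightarrow> carrier (group_algebra R G) = carrier G \<rightarrow>\<^sub>E carrier R"
  by (auto simp: group_algebra_def)

lemma group_algebra_simps:
  "\<one>\<^bsub>group_algebra R G\<^esub> = group_element R G \<one>\<^bsub>G\<^esub>"
  "\<zero>\<^bsub>group_algebra R G\<^esub> = (\<lambda>g\<in>carrier G. \<zero>\<^bsub>R\<^esub>)"
  "u \<oplus>\<^bsub>group_algebra R G\<^esub> w = (\<lambda>g\<in>carrier G. u g \<oplus>\<^bsub>R\<^esub> w g)"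
  "c \<odot>\<^bsub>group_algebra R G\<^esub> u = (\<lambda>g\<in>carrier G. c \<otimes>\<^bsub>R\<^esub> u g)"
  by (simp_all add: group_algebra_def group_element_def)

locale finite_group_algebra = R: cring R + G: comm_group G
  for R (structure) and G (structure) +
  assumes finite_G: "finite (carrier G)"
begin

section \<open>Convolution and the laws of an algebra\<close>

abbreviation A where "A \<equiv> group_algebra R G"

lemma A_closed: "u \<in> carrier A \<Longrightarrow> g \<in> carrier G \<Longrightarrow> u g \<in> carrier R"
  by (auto simp: carrier_group_algebra[OF finite_G])

lemma A_memI: "(\<And>g. g \<in> carrier G \<Longrightarrow> f g \<in> carrier R) \<Longrightarrow> (\<lambda>g\<in>carrier G. f g) \<in> carrier A"
  by (auto simp: carrier_group_algebra[OF finite_G])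

lemma A_eqI:
  assumes "u \<in> carrier A" "w \<in> carrier A" "\<And>g. g \<in> carrier G \<Longrightarrow> u g = w g"
  shows "u = w"
  using assms by (auto simp: carrier_group_algebra[OF finite_G] intro: PiE_ext)

text \<open>Terms outside the support of \<open>u\<close> are zero. With a range independent of
  \<open>u\<close>, sums can be reindexed by translation and inversion.\<close>

lemma mult_apply:
  assumes u: "u \<in> carrier A" and w: "w \<in> carrier A" and g: "g \<in> carrier G"
  shows "(u \<otimes>\<^bsub>A\<^esub> w) g = (\<Oplus>\<^bsub>R\<^esub>h\<in>carrier G. u h \<otimes>\<^bsub>R\<^esub> w (inv\<^bsub>G\<^esub> h \<otimes>\<^bsub>G\<^esub> g))"
proof -
  have "(u \<otimes>\<^bsub>A\<^esub> w) g =
      (\<Oplus>\<^bsub>R\<^esub>h\<in>{h \<in> carrier G. u h \<noteq> \<zero>\<^bsub>R\<^esub>}. u h \<otimes>\<^bsub>R\<^esub> w (inv\<^bsub>G\<^esub> h \<otimes>\<^bsub>G\<^esub> g))"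
    using g by (simp add: group_algebra_def)
  also have "\<dots> = (\<Oplus>\<^bsub>R\<^esub>h\<in>carrier G. u h \<otimes>\<^bsub>R\<^esub> w (inv\<^bsub>G\<^esub> h \<otimes>\<^bsub>G\<^esub> g))"
    using finite_G g A_closed[OF u] A_closed[OF w]
    by (intro R.add.finprod_mono_neutral_cong_left) auto
  finally show ?thesis .
qed

lemma mult_closed:
  assumes u: "u \<in> carrier A" and w: "w \<in> carrier A"
  shows "u \<otimes>\<^bsub>A\<^esub> w \<in> carrier A"
proof -
  have "u \<otimes>\<^bsub>A\<^esub> w = (\<lambda>g\<in>carrier G. (u \<otimes>\<^bsub>A\<^esub> w) g)"
    by (auto simp: group_algebra_def)
  also have "\<dots> \<in> carrier A"
    using A_closed[OF u] A_closed[OF w]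
    by (intro A_memI) (auto simp: mult_apply[OF u w] intro!: R.finsum_closed)
  finally show ?thesis .
qed

lemma finsum_translate:
  assumes "a \<in> carrier G" "\<And>g. g \<in> carrier G \<Longrightarrow> f g \<in> carrier R"
  shows "(\<Oplus>\<^bsub>R\<^esub>h\<in>carrier G. f (a \<otimes>\<^bsub>G\<^esub> h)) = (\<Oplus>\<^bsub>R\<^esub>h\<in>carrier G. f h)"
  using R.finsum_reindex[of f "(\<otimes>\<^bsub>G\<^esub>) a" "carrier G"] assms
  by (auto simp: G.inj_on_cmult G.surj_const_mult)

lemma finsum_inverse:
  assumes "\<And>g. g \<in> carrier G \<Longrightarrow> f g \<in> carrier R"
  shows "(\<Oplus>\<^bsub>R\<^esub>h\<in>carrier G. f (inv\<^bsub>G\<^esub> h)) = (\<Oplus>\<^bsub>R\<^esub>h\<in>carrier G. f h)"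
proof -
  have "m_inv G ` carrier G = carrier G"
    using G.inv_closed G.inv_inv by (metis (no_types, lifting) image_subset_iff subsetI subset_antisym image_eqI)
  then show ?thesis
    using R.finsum_reindex[of f "m_inv G" "carrier G"] assms G.inv_inj by auto
qed

text \<open>Replacing \<open>h\<close> by \<open>g h^-1\<close>, as a translation followed by an
  inversion, exchanges the two factors. Commutativity of the group identifies \<open>g h^-1\<close>
  with \<open>h^-1 g\<close>.\<close>

lemma mult_comm:
  assumes u: "u \<in> carrier A" and w: "w \<in> carrier A"
  shows "u \<otimes>\<^bsub>A\<^esub> w = w \<otimes>\<^bsub>A\<^esub> u"
proof (rule A_eqI)
  fix g assume g: "g \<in> carrier G"
  let ?f = "\<lambda>h. u h \<otimes>\<^bsub>R\<^esub> w (inv\<^bsub>G\<^esub> h \<otimes>\<^bsub>G\<^esub> g)"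
  have f: "?f h \<in> carrier R" if "h \<in> carrier G" for h
    using that g A_closed[OF u] A_closed[OF w] by simp
  have "(u \<otimes>\<^bsub>A\<^esub> w) g = (\<Oplus>\<^bsub>R\<^esub>h\<in>carrier G. ?f h)"
    by (rule mult_apply[OF u w g])
  also have "\<dots> = (\<Oplus>\<^bsub>R\<^esub>h\<in>carrier G. ?f (g \<otimes>\<^bsub>G\<^esub> h))"
    by (rule finsum_translate[OF g f, symmetric])
  also have "\<dots> = (\<Oplus>\<^bsub>R\<^esub>h\<in>carrier G. ?f (g \<otimes>\<^bsub>G\<^esub> inv\<^bsub>G\<^esub> h))"
    using g f by (intro finsum_inverse[symmetric]) auto
  also have "\<dots> = (\<Oplus>\<^bsub>R\<^esub>h\<in>carrier G. w h \<otimes>\<^bsub>R\<^esub> u (inv\<^bsub>G\<^esub> h \<otimes>\<^bsub>G\<^esub> g))"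
  proof (rule R.finsum_cong')
    fix h assume h: "h \<in> carrier G"
    have "inv\<^bsub>G\<^esub> (g \<otimes>\<^bsub>G\<^esub> inv\<^bsub>G\<^esub> h) \<otimes>\<^bsub>G\<^esub> g = h"
      using g h by (simp add: G.inv_mult_group G.m_assoc)
    moreover have "g \<otimes>\<^bsub>G\<^esub> inv\<^bsub>G\<^esub> h = inv\<^bsub>G\<^esub> h \<otimes>\<^bsub>G\<^esub> g"
      using g h by (simp add: G.m_comm)
    ultimately show "?f (g \<otimes>\<^bsub>G\<^esub> inv\<^bsub>G\<^esub> h) = w h \<otimes>\<^bsub>R\<^esub> u (inv\<^bsub>G\<^esub> h \<otimes>\<^bsub>G\<^esub> g)"
      using g h A_closed[OF u] A_closed[OF w] by (simp add: R.m_comm)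
  qed (use g A_closed[OF u] A_closed[OF w] in auto)
  also have "\<dots> = (w \<otimes>\<^bsub>A\<^esub> u) g"
    by (rule mult_apply[OF w u g, symmetric])
  finally show "(u \<otimes>\<^bsub>A\<^esub> w) g = (w \<otimes>\<^bsub>A\<^esub> u) g" .
qed (use mult_closed u w in auto)

lemma mult_assoc:
  assumes u: "u \<in> carrier A" and w: "w \<in> carrier A" and z: "z \<in> carrier A"
  shows "u \<otimes>\<^bsub>A\<^esub> w \<otimes>\<^bsub>A\<^esub> z = u \<otimes>\<^bsub>A\<^esub> (w \<otimes>\<^bsub>A\<^esub> z)"
proof (rule A_eqI)
  fix g assume g: "g \<in> carrier G"
  note cl = A_closed[OF u] A_closed[OF w] A_closed[OF z]
  let ?f = "\<lambda>h k. u h \<otimes>\<^bsub>R\<^esub> (w (inv\<^bsub>G\<^esub> h \<otimes>\<^bsub>G\<^esub> k) \<otimes>\<^bsub>R\<^esub> z (inv\<^bsub>G\<^esub> k \<otimes>\<^bsub>G\<^esub> g))"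
  have "(u \<otimes>\<^bsub>A\<^esub> w \<otimes>\<^bsub>A\<^esub> z) g = (\<Oplus>\<^bsub>R\<^esub>k\<in>carrier G. (u \<otimes>\<^bsub>A\<^esub> w) k \<otimes>\<^bsub>R\<^esub> z (inv\<^bsub>G\<^esub> k \<otimes>\<^bsub>G\<^esub> g))"
    by (rule mult_apply[OF mult_closed[OF u w] z g])
  also have "\<dots> = (\<Oplus>\<^bsub>R\<^esub>k\<in>carrier G. \<Oplus>\<^bsub>R\<^esub>h\<in>carrier G. ?f h k)"
    using g finite_G cl
    by (intro R.finsum_cong')
      (auto simp: mult_apply[OF u w] R.finsum_ldistr R.m_assoc intro!: R.finsum_cong' R.finsum_closed)
  also have "\<dots> = (\<Oplus>\<^bsub>R\<^esub>h\<in>carrier G. \<Oplus>\<^bsub>R\<^esub>k\<in>carrier G. ?f h k)"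
    using g finite_G cl by (intro R.finsum_swap) auto
  also have "\<dots> = (\<Oplus>\<^bsub>R\<^esub>h\<in>carrier G. u h \<otimes>\<^bsub>R\<^esub> (w \<otimes>\<^bsub>A\<^esub> z) (inv\<^bsub>G\<^esub> h \<otimes>\<^bsub>G\<^esub> g))"
  proof (rule R.finsum_cong')
    fix h assume h: "h \<in> carrier G"
    \<comment> \<open>Translating \<open>k\<close> to \<open>h k\<close> cancels \<open>h\<close> in
      the argument of \<open>w\<close>, so that \<open>u h\<close> factors out of a convolution of
      \<open>w\<close> and \<open>z\<close>.\<close>
    have "(\<Oplus>\<^bsub>R\<^esub>k\<in>carrier G. ?f h k) = (\<Oplus>\<^bsub>R\<^esub>k\<in>carrier G. ?f h (h \<otimes>\<^bsub>G\<^esub> k))"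
      using g h cl by (intro finsum_translate[symmetric]) auto
    also have "\<dots> = (\<Oplus>\<^bsub>R\<^esub>k\<in>carrier G. u h \<otimes>\<^bsub>R\<^esub>
        (w k \<otimes>\<^bsub>R\<^esub> z (inv\<^bsub>G\<^esub> k \<otimes>\<^bsub>G\<^esub> (inv\<^bsub>G\<^esub> h \<otimes>\<^bsub>G\<^esub> g))))"
      using g h cl
      by (intro R.finsum_cong') (auto simp: G.inv_mult_group G.m_assoc G.m_assoc[symmetric, of "inv\<^bsub>G\<^esub> h" h])
    also have "\<dots> = u h \<otimes>\<^bsub>R\<^esub> (w \<otimes>\<^bsub>A\<^esub> z) (inv\<^bsub>G\<^esub> h \<otimes>\<^bsub>G\<^esub> g)"
      using g h cl finite_G by (simp add: mult_apply[OF w z] R.finsum_rdistr Pi_def)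
    finally show "(\<Oplus>\<^bsub>R\<^esub>k\<in>carrier G. ?f h k) = u h \<otimes>\<^bsub>R\<^esub> (w \<otimes>\<^bsub>A\<^esub> z) (inv\<^bsub>G\<^esub> h \<otimes>\<^bsub>G\<^esub> g)" .
  qed (use g cl A_closed[OF mult_closed[OF w z]] in auto)
  also have "\<dots> = (u \<otimes>\<^bsub>A\<^esub> (w \<otimes>\<^bsub>A\<^esub> z)) g"
    by (rule mult_apply[OF u mult_closed[OF w z] g, symmetric])
  finally show "(u \<otimes>\<^bsub>A\<^esub> w \<otimes>\<^bsub>A\<^esub> z) g = (u \<otimes>\<^bsub>A\<^esub> (w \<otimes>\<^bsub>A\<^esub> z)) g" .
qed (use mult_closed u w z in auto)

lemma group_element_closed: "group_element R G g \<in> carrier A"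
  unfolding group_element_def by (rule A_memI) auto

text \<open>Only the summand \<open>h = a\<close> survives, so multiplication by a group element
  translates coefficients. The unit law and the products of group elements follow from this.\<close>

lemma group_element_mult_apply:
  assumes a: "a \<in> carrier G" and w: "w \<in> carrier A" and g: "g \<in> carrier G"
  shows "(group_element R G a \<otimes>\<^bsub>A\<^esub> w) g = w (inv\<^bsub>G\<^esub> a \<otimes>\<^bsub>G\<^esub> g)"
proof -
  have "(group_element R G a \<otimes>\<^bsub>A\<^esub> w) g =
      (\<Oplus>\<^bsub>R\<^esub>h\<in>carrier G. group_element R G a h \<otimes>\<^bsub>R\<^esub> w (inv\<^bsub>G\<^esub> h \<otimes>\<^bsub>G\<^esub> g))"
    by (rule mult_apply[OF group_element_closed w g])
  also have "\<dots> = (\<Oplus>\<^bsub>R\<^esub>h\<in>carrier G. if h = a then w (inv\<^bsub>G\<^esub> h \<otimes>\<^bsub>G\<^esub> g) else \<zero>\<^bsub>R\<^esub>)"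
    using a g A_closed[OF w] by (intro R.finsum_cong') (auto simp: group_element_def)
  also have "\<dots> = w (inv\<^bsub>G\<^esub> a \<otimes>\<^bsub>G\<^esub> g)"
    using a g A_closed[OF w] finite_G by (intro R.add.finprod_singleton_swap) auto
  finally show ?thesis .
qed

lemma group_element_mult:
  assumes a: "a \<in> carrier G" and b: "b \<in> carrier G"
  shows "group_element R G a \<otimes>\<^bsub>A\<^esub> group_element R G b = group_element R G (a \<otimes>\<^bsub>G\<^esub> b)"
proof (rule A_eqI)
  fix g assume g: "g \<in> carrier G"
  have "inv\<^bsub>G\<^esub> a \<otimes>\<^bsub>G\<^esub> g = b \<longleftrightarrow> g = a \<otimes>\<^bsub>G\<^esub> b"
    using a b g by (metis G.inv_solve_left)
  then show "(group_element R G a \<otimes>\<^bsub>A\<^esub> group_element R G b) g = group_element R G (a \<otimes>\<^bsub>G\<^esub> b) g"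
    using a b g by (simp add: group_element_mult_apply group_element_closed) (simp add: group_element_def)
qed (auto intro: mult_closed group_element_closed)

sublocale algebra R A
proof (rule algebraI)
  show "cring R" ..
  show "cring A"
  proof (rule cringI)
    show "abelian_group A"
    proof (rule abelian_groupI)
      fix u assume u: "u \<in> carrier A"
      show "\<exists>w\<in>carrier A. w \<oplus>\<^bsub>A\<^esub> u = \<zero>\<^bsub>A\<^esub>"
        by (rule bexI[of _ "\<lambda>g\<in>carrier G. \<ominus>\<^bsub>R\<^esub> u g"])
          (use A_closed[OF u] in \<open>auto simp: group_algebra_simps R.l_neg intro!: A_memI\<close>)
      show "\<zero>\<^bsub>A\<^esub> \<oplus>\<^bsub>A\<^esub> u = u"
        by (rule A_eqI) (use A_closed[OF u] u in \<open>auto simp: group_algebra_simps intro!: A_memI\<close>)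
    qed (auto simp: group_algebra_simps A_closed R.a_ac intro!: A_memI restrict_ext)
    show "comm_monoid A"
    proof (rule comm_monoidI)
      fix u assume u: "u \<in> carrier A"
      show "\<one>\<^bsub>A\<^esub> \<otimes>\<^bsub>A\<^esub> u = u"
        by (rule A_eqI) (use u in \<open>auto simp: group_algebra_simps(1) group_element_mult_apply
          intro!: mult_closed group_element_closed\<close>)
    qed (auto simp: group_algebra_simps(1) group_element_closed mult_closed mult_assoc intro: mult_comm)
    fix u w z assume *: "u \<in> carrier A" "w \<in> carrier A" "z \<in> carrier A"
    have uw: "u \<oplus>\<^bsub>A\<^esub> w \<in> carrier A"
      using * by (auto simp: group_algebra_simps A_closed intro!: A_memI)
    show "(u \<oplus>\<^bsub>A\<^esub> w) \<otimes>\<^bsub>A\<^esub> z = u \<otimes>\<^bsub>A\<^esub> z \<oplus>\<^bsub>A\<^esub> w \<otimes>\<^bsub>A\<^esub> z"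
    proof (rule A_eqI)
      fix g assume g: "g \<in> carrier G"
      note cl = *[THEN A_closed]
      have "((u \<oplus>\<^bsub>A\<^esub> w) \<otimes>\<^bsub>A\<^esub> z) g = (\<Oplus>\<^bsub>R\<^esub>h\<in>carrier G.
          u h \<otimes>\<^bsub>R\<^esub> z (inv\<^bsub>G\<^esub> h \<otimes>\<^bsub>G\<^esub> g) \<oplus>\<^bsub>R\<^esub> w h \<otimes>\<^bsub>R\<^esub> z (inv\<^bsub>G\<^esub> h \<otimes>\<^bsub>G\<^esub> g))"
        unfolding mult_apply[OF uw *(3) g] using g cl
        by (intro R.finsum_cong') (auto simp: group_algebra_simps R.l_distr)
      also have "\<dots> = (u \<otimes>\<^bsub>A\<^esub> z) g \<oplus>\<^bsub>R\<^esub> (w \<otimes>\<^bsub>A\<^esub> z) g"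
        unfolding mult_apply[OF *(1,3) g] mult_apply[OF *(2,3) g]
        using g cl by (intro R.finsum_addf) auto
      finally show "((u \<oplus>\<^bsub>A\<^esub> w) \<otimes>\<^bsub>A\<^esub> z) g = (u \<otimes>\<^bsub>A\<^esub> z \<oplus>\<^bsub>A\<^esub> w \<otimes>\<^bsub>A\<^esub> z) g"
        using g by (simp add: group_algebra_simps(3))
    next
      show "u \<otimes>\<^bsub>A\<^esub> z \<oplus>\<^bsub>A\<^esub> w \<otimes>\<^bsub>A\<^esub> z \<in> carrier A"
        using * by (auto simp: group_algebra_simps(3) A_closed[OF mult_closed] intro!: A_memI)
    qed (use * uw mult_closed in auto)
  qed
  fix a u w assume *: "a \<in> carrier R" "u \<in> carrier A" "w \<in> carrier A"
  note cl = *(2,3)[THEN A_closed]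
  have au: "a \<odot>\<^bsub>A\<^esub> u \<in> carrier A" and auw: "a \<odot>\<^bsub>A\<^esub> (u \<otimes>\<^bsub>A\<^esub> w) \<in> carrier A"
    using * by (auto simp: group_algebra_simps A_closed A_closed[OF mult_closed] intro!: A_memI)
  show "a \<odot>\<^bsub>A\<^esub> u \<otimes>\<^bsub>A\<^esub> w = a \<odot>\<^bsub>A\<^esub> (u \<otimes>\<^bsub>A\<^esub> w)"
  proof (rule A_eqI)
    fix g assume g: "g \<in> carrier G"
    have "(a \<odot>\<^bsub>A\<^esub> u \<otimes>\<^bsub>A\<^esub> w) g =
        (\<Oplus>\<^bsub>R\<^esub>h\<in>carrier G. a \<otimes>\<^bsub>R\<^esub> (u h \<otimes>\<^bsub>R\<^esub> w (inv\<^bsub>G\<^esub> h \<otimes>\<^bsub>G\<^esub> g)))"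
      unfolding mult_apply[OF au *(3) g] using g cl *(1)
      by (intro R.finsum_cong') (auto simp: group_algebra_simps(4) R.m_assoc)
    also have "\<dots> = a \<otimes>\<^bsub>R\<^esub> (u \<otimes>\<^bsub>A\<^esub> w) g"
      unfolding mult_apply[OF *(2,3) g] using g cl *(1) finite_G
      by (intro R.finsum_rdistr[symmetric]) auto
    finally show "(a \<odot>\<^bsub>A\<^esub> u \<otimes>\<^bsub>A\<^esub> w) g = (a \<odot>\<^bsub>A\<^esub> (u \<otimes>\<^bsub>A\<^esub> w)) g"
      using g by (simp add: group_algebra_simps(4))
  qed (use * au auw mult_closed in auto)
qed (auto simp: group_algebra_simps(3,4) A_closed R.l_distr R.r_distr R.m_assoc
    intro!: A_memI intro: A_eqI)

lemma finsum_apply: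
  assumes "finite I" "\<And>i. i \<in> I \<Longrightarrow> f i \<in> carrier A" and g: "g \<in> carrier G"
  shows "(\<Oplus>\<^bsub>A\<^esub>i\<in>I. f i) g = (\<Oplus>\<^bsub>R\<^esub>i\<in>I. f i g)"
  using assms(1,2)
proof (induction I)
  case empty
  then show ?case using g by (simp add: group_algebra_simps)
next
  case (insert i I)
  then show ?case
    using g by (subst M.finsum_insert) (auto simp: group_algebra_simps(3) A_closed)
qed

lemma group_element_pow:
  assumes "a \<in> carrier G"
  shows "group_element R G a [^]\<^bsub>A\<^esub> (k::nat) = group_element R G (a [^]\<^bsub>G\<^esub> k)"
  using assms by (induction k) (auto simp: group_algebra_simps(1) group_element_mult)

text \<open>The powers of \<open>a\<close> enumerate the group without repetition, so at
  \<open>a^j\<close> only the summand \<open>i = j\<close> is nonzero. This supplies the spanning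
  condition \<open>g_span\<close>.\<close>

lemma group_algebra_expand:
  assumes a: "a \<in> carrier G" and inj: "inj_on (\<lambda>i. a [^]\<^bsub>G\<^esub> i) {..<n::nat}"
    and gen: "carrier G = (\<lambda>i. a [^]\<^bsub>G\<^esub> i) ` {..<n}" and u: "u \<in> carrier A"
  shows "u = (\<Oplus>\<^bsub>A\<^esub>i\<in>{..<n}. u (a [^]\<^bsub>G\<^esub> i) \<odot>\<^bsub>A\<^esub> group_element R G a [^]\<^bsub>A\<^esub> i)"
proof (rule A_eqI)
  fix g assume "g \<in> carrier G"
  then obtain j where j: "j < n" "g = a [^]\<^bsub>G\<^esub> j"
    using gen by auto
  have "(\<Oplus>\<^bsub>A\<^esub>i\<in>{..<n}. u (a [^]\<^bsub>G\<^esub> i) \<odot>\<^bsub>A\<^esub> group_element R G a [^]\<^bsub>A\<^esub> i) g =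
      (\<Oplus>\<^bsub>R\<^esub>i\<in>{..<n}. (u (a [^]\<^bsub>G\<^esub> i) \<odot>\<^bsub>A\<^esub> group_element R G a [^]\<^bsub>A\<^esub> i) g)"
    using a u \<open>g \<in> _\<close> by (intro finsum_apply) (auto simp: A_closed group_element_closed)
  also have "\<dots> = (\<Oplus>\<^bsub>R\<^esub>i\<in>{..<n}. if i = j then u (a [^]\<^bsub>G\<^esub> i) else \<zero>\<^bsub>R\<^esub>)"
  proof (rule R.finsum_cong')
    fix i assume "i \<in> {..<n}"
    then have "a [^]\<^bsub>G\<^esub> j = a [^]\<^bsub>G\<^esub> i \<longleftrightarrow> i = j"
      using inj j by (auto dest: inj_onD)
    then show "(u (a [^]\<^bsub>G\<^esub> i) \<odot>\<^bsub>A\<^esub> group_element R G a [^]\<^bsub>A\<^esub> i) g =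
        (if i = j then u (a [^]\<^bsub>G\<^esub> i) else \<zero>\<^bsub>R\<^esub>)"
      using a u j
      by (simp add: group_algebra_simps(4) group_element_pow A_closed) (simp add: group_element_def A_closed)
  qed (use a u in \<open>auto simp: A_closed\<close>)
  also have "\<dots> = u g"
    using a u j by (subst R.add.finprod_singleton_swap) (auto simp: A_closed)
  finally show "u g = (\<Oplus>\<^bsub>A\<^esub>i\<in>{..<n}. u (a [^]\<^bsub>G\<^esub> i) \<odot>\<^bsub>A\<^esub> group_element R G a [^]\<^bsub>A\<^esub> i) g"
    by simp
qed (use u a in \<open>auto simp: A_closed group_element_closed intro!: M.finsum_closed\<close>)

section \<open>Conjugation as an involutive algebra automorphism\<close>

lemma conjugation_closed: "u \<in> carrier A \<Longrightarrow> conjugation G u \<in> carrier A"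
  unfolding conjugation_def by (rule A_memI) (auto simp: A_closed)

lemma conjugation_conjugation: "u \<in> carrier A \<Longrightarrow> conjugation G (conjugation G u) = u"
  by (rule A_eqI[OF conjugation_closed[OF conjugation_closed]]) (auto simp: conjugation_def)

lemma conjugation_smult:
  "c \<in> carrier R \<Longrightarrow> u \<in> carrier A \<Longrightarrow> conjugation G (c \<odot>\<^bsub>A\<^esub> u) = c \<odot>\<^bsub>A\<^esub> conjugation G u"
  by (auto simp: conjugation_def group_algebra_simps)

text \<open>Reindexing the convolution by inversion gives the product of the conjugates. Inversion
  reverses products, so multiplicativity rests on commutativity of the group.\<close>

lemma conjugation_ring_hom: "conjugation G \<in> ring_hom A A"
proof (rule ring_hom_memI)
  fix u w assume u: "u \<in> carrier A" and w: "w \<in> carrier A"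
  show "conjugation G (u \<oplus>\<^bsub>A\<^esub> w) = conjugation G u \<oplus>\<^bsub>A\<^esub> conjugation G w"
    by (auto simp: conjugation_def group_algebra_simps)
  show "conjugation G (u \<otimes>\<^bsub>A\<^esub> w) = conjugation G u \<otimes>\<^bsub>A\<^esub> conjugation G w"
  proof (rule A_eqI)
    fix g assume g: "g \<in> carrier G"
    let ?f = "\<lambda>h. u h \<otimes>\<^bsub>R\<^esub> w (inv\<^bsub>G\<^esub> h \<otimes>\<^bsub>G\<^esub> inv\<^bsub>G\<^esub> g)"
    have "conjugation G (u \<otimes>\<^bsub>A\<^esub> w) g = (\<Oplus>\<^bsub>R\<^esub>h\<in>carrier G. ?f h)"
      using g by (simp add: conjugation_def mult_apply[OF u w])
    also have "\<dots> = (\<Oplus>\<^bsub>R\<^esub>h\<in>carrier G. ?f (inv\<^bsub>G\<^esub> h))"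
      using g u w by (intro finsum_inverse[symmetric]) (auto simp: A_closed)
    also have "\<dots> = (conjugation G u \<otimes>\<^bsub>A\<^esub> conjugation G w) g"
      unfolding mult_apply[OF conjugation_closed[OF u] conjugation_closed[OF w] g]
      using g u w
      by (intro R.finsum_cong') (auto simp: A_closed conjugation_def G.inv_mult G.m_comm)
    finally show "conjugation G (u \<otimes>\<^bsub>A\<^esub> w) g = (conjugation G u \<otimes>\<^bsub>A\<^esub> conjugation G w) g" .
  qed (use u w conjugation_closed in auto)
next
  show "conjugation G \<one>\<^bsub>A\<^esub> = \<one>\<^bsub>A\<^esub>"
    by (simp add: group_algebra_simps(1) conjugation_group_element[OF G.is_group])
qed (rule conjugation_closed)

end

section \<open>Unitary elements\<close>

text \<open>An abstract form of the group algebra of a cyclic \<open>p\<close>-group with generator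
  \<open>g\<close> and conjugation \<open>cj\<close>. That the powers of \<open>g\<close> form a
  basis is encoded by spanning together with the cardinality of \<open>A\<close>.\<close>

locale cyclic_p_algebra = R: domain R + A: cring A + algebra R A
  for R :: "('r, 'x) ring_scheme" (structure) and A :: "('r, 'a, 'y) module_scheme" (structure) +
  fixes p m n :: nat and g and cj
  assumes prime_p: "prime p" and odd_p: "odd p" and n_def: "n = p ^ m"
    and char_R: "[p] \<cdot>\<^bsub>R\<^esub> \<one>\<^bsub>R\<^esub> = \<zero>\<^bsub>R\<^esub>"
    and finite_R: "finite (carrier R)"
    and g_closed [simp]: "g \<in> carrier A"
    and g_pow_n: "g [^]\<^bsub>A\<^esub> n = \<one>\<^bsub>A\<^esub>"
    and g_span: "u \<in> carrier A \<Longrightarrow>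
      \<exists>c\<in>{..<n} \<rightarrow> carrier R. u = (\<Oplus>\<^bsub>A\<^esub>i\<in>{..<n}. c i \<odot>\<^bsub>A\<^esub> g [^]\<^bsub>A\<^esub> i)"
    and card_A: "card (carrier A) = card (carrier R) ^ n"
    and cj_hom: "cj \<in> ring_hom A A"
    and cj_cj: "u \<in> carrier A \<Longrightarrow> cj (cj u) = u"
    and cj_smult: "a \<in> carrier R \<Longrightarrow> u \<in> carrier A \<Longrightarrow> cj (a \<odot>\<^bsub>A\<^esub> u) = a \<odot>\<^bsub>A\<^esub> cj u"
    and cj_g: "cj g \<otimes>\<^bsub>A\<^esub> g = \<one>\<^bsub>A\<^esub>"
begin

interpretation cj: ring_hom_cring A A cj
  by unfold_locales (rule cj_hom)

lemma n_pos: "0 < n"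
  using prime_p by (simp add: n_def prime_gt_0_nat)

lemma char_A: "[p] \<cdot>\<^bsub>A\<^esub> \<one>\<^bsub>A\<^esub> = \<zero>\<^bsub>A\<^esub>"
  using add_pow_smult[of "\<one>\<^bsub>R\<^esub>" "\<one>\<^bsub>A\<^esub>" p] by (simp add: char_R)

section \<open>The nilpotent element \<open>x\<close> and the powers of \<open>g\<close>\<close>

definition x where "x = g \<ominus>\<^bsub>A\<^esub> \<one>\<^bsub>A\<^esub>"

lemma x_closed [simp]: "x \<in> carrier A"
  by (simp add: x_def)

lemma x_plus_one: "x \<oplus>\<^bsub>A\<^esub> \<one>\<^bsub>A\<^esub> = g"
  by (simp add: x_def A.minus_eq A.a_assoc A.l_neg)

lemma x_pow_n: "x [^]\<^bsub>A\<^esub> n = \<zero>\<^bsub>A\<^esub>"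
proof -
  have "x [^]\<^bsub>A\<^esub> n \<oplus>\<^bsub>A\<^esub> \<one>\<^bsub>A\<^esub> = \<one>\<^bsub>A\<^esub>"
    using g_pow_n A.frobenius_power_add[OF prime_p char_A x_closed A.one_closed]
    by (simp add: x_plus_one n_def)
  then have "x [^]\<^bsub>A\<^esub> n \<oplus>\<^bsub>A\<^esub> \<one>\<^bsub>A\<^esub> = \<zero>\<^bsub>A\<^esub> \<oplus>\<^bsub>A\<^esub> \<one>\<^bsub>A\<^esub>"
    by simp
  then show ?thesis
    by (subst (asm) A.add.right_cancel) auto
qed

lemma x_pow_ge: "n \<le> k \<Longrightarrow> x [^]\<^bsub>A\<^esub> k = \<zero>\<^bsub>A\<^esub>"
  using A.nat_pow_mult[OF x_closed, of n "k - n"] by (simp add: x_pow_n)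

lemma g_pow_expand: "g [^]\<^bsub>A\<^esub> (k::nat) = (\<Oplus>\<^bsub>A\<^esub>i\<in>{..<n}. ([(k choose i)] \<cdot>\<^bsub>R\<^esub> \<one>\<^bsub>R\<^esub>) \<odot>\<^bsub>A\<^esub> x [^]\<^bsub>A\<^esub> i)"
proof -
  have "g [^]\<^bsub>A\<^esub> k = (\<Oplus>\<^bsub>A\<^esub>i\<in>{..k}. [(k choose i)] \<cdot>\<^bsub>A\<^esub> (x [^]\<^bsub>A\<^esub> i \<otimes>\<^bsub>A\<^esub> \<one>\<^bsub>A\<^esub> [^]\<^bsub>A\<^esub> (k - i)))"
    using A.binomial_ring[OF x_closed A.one_closed, of k] by (simp add: x_plus_one)
  \<comment> \<open>The range \<open>{..<n}\<close> serves every \<open>k\<close>: powers of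
    \<open>x\<close> from degree \<open>n\<close> on vanish, and binomial coefficients beyond
    \<open>k\<close> are zero.\<close>
  also have "\<dots> = (\<Oplus>\<^bsub>A\<^esub>i\<in>{..<n}. ([(k choose i)] \<cdot>\<^bsub>R\<^esub> \<one>\<^bsub>R\<^esub>) \<odot>\<^bsub>A\<^esub> x [^]\<^bsub>A\<^esub> i)"
    by (intro A.add.finprod_mono_neutral_cong)
      (auto simp: add_pow_smult x_pow_ge binomial_eq_0)
  finally show ?thesis .
qed

section \<open>Coordinates with respect to the powers of \<open>x\<close>\<close>

definition lin where "lin c = (\<Oplus>\<^bsub>A\<^esub>i\<in>{..<n}. c i \<odot>\<^bsub>A\<^esub> x [^]\<^bsub>A\<^esub> i)"

lemma lin_closed: "c \<in> {..<n} \<rightarrow> carrier R \<Longrightarrow> lin c \<in> carrier A"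
  unfolding lin_def by (intro A.finsum_closed) auto

lemma lin_cong: "c \<in> {..<n} \<rightarrow> carrier R \<Longrightarrow> (\<And>i. i < n \<Longrightarrow> d i = c i) \<Longrightarrow> lin d = lin c"
  unfolding lin_def by (intro A.finsum_cong') auto

text \<open>Expanding each power of \<open>g\<close> in powers of \<open>x\<close> and exchanging
  the sums turns one spanning set into the other.\<close>

lemma lin_surj:
  assumes "u \<in> carrier A"
  shows "\<exists>c\<in>{..<n} \<rightarrow> carrier R. u = lin c"
proof -
  obtain c where c: "c \<in> {..<n} \<rightarrow> carrier R"
    and u: "u = (\<Oplus>\<^bsub>A\<^esub>i\<in>{..<n}. c i \<odot>\<^bsub>A\<^esub> g [^]\<^bsub>A\<^esub> i)"
    using g_span[OF assms] by blast
  let ?b = "\<lambda>i k. c i \<otimes>\<^bsub>R\<^esub> ([(i choose k)] \<cdot>\<^bsub>R\<^esub> \<one>\<^bsub>R\<^esub>)"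
  have "u = (\<Oplus>\<^bsub>A\<^esub>i\<in>{..<n}. \<Oplus>\<^bsub>A\<^esub>k\<in>{..<n}. ?b i k \<odot>\<^bsub>A\<^esub> x [^]\<^bsub>A\<^esub> k)"
    unfolding u using c
    by (intro A.finsum_cong')
      (auto simp: g_pow_expand smult_finsum_right smult_assoc1 Pi_iff intro!: A.finsum_cong' A.finsum_closed)
  also have "\<dots> = (\<Oplus>\<^bsub>A\<^esub>k\<in>{..<n}. \<Oplus>\<^bsub>A\<^esub>i\<in>{..<n}. ?b i k \<odot>\<^bsub>A\<^esub> x [^]\<^bsub>A\<^esub> k)"
    using c by (intro A.finsum_swap) (auto simp: Pi_iff)
  also have "\<dots> = lin (\<lambda>k. \<Oplus>\<^bsub>R\<^esub>i\<in>{..<n}. ?b i k)"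
    unfolding lin_def
  proof (rule A.finsum_cong')
    fix k
    show "(\<Oplus>\<^bsub>A\<^esub>i\<in>{..<n}. ?b i k \<odot>\<^bsub>A\<^esub> x [^]\<^bsub>A\<^esub> k) = (\<Oplus>\<^bsub>R\<^esub>i\<in>{..<n}. ?b i k) \<odot>\<^bsub>A\<^esub> x [^]\<^bsub>A\<^esub> k"
      using c by (intro smult_finsum_left[symmetric]) auto
  qed (use c in \<open>auto intro!: smult_closed R.finsum_closed\<close>)
  finally show ?thesis
    using c by (intro bexI[of _ "\<lambda>k. \<Oplus>\<^bsub>R\<^esub>i\<in>{..<n}. ?b i k"]) (auto intro!: R.finsum_closed)
qed

text \<open>Linear independence by counting: there are as many coefficient vectors as elements of
  \<open>A\<close>, so the surjection \<open>lin\<close> between finite sets is injective.\<close>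

lemma lin_inj:
  assumes "c \<in> {..<n} \<rightarrow> carrier R" "d \<in> {..<n} \<rightarrow> carrier R" "lin c = lin d" "i < n"
  shows "c i = d i"
proof -
  \<comment> \<open>Extensional functions represent each coefficient vector exactly once; values
    from index \<open>n\<close> on do not affect \<open>lin\<close>.\<close>
  let ?E = "{..<n} \<rightarrow>\<^sub>E carrier R"
  have restr: "lin (restrict e {..<n}) = lin e" if "e \<in> {..<n} \<rightarrow> carrier R" for e
    using that by (intro lin_cong) auto
  have "lin ` ?E = carrier A"
  proof
    show "carrier A \<subseteq> lin ` ?E"
    proof
      fix u assume "u \<in> carrier A"
      then obtain e where e: "e \<in> {..<n} \<rightarrow> carrier R" "u = lin e"
        using lin_surj by blast
      then show "u \<in> lin ` ?E"
        using restr[OF e(1)] by (intro image_eqI[of _ _ "restrict e {..<n}"]) auto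
    qed
  qed (auto intro!: lin_closed)
  moreover have "card ?E = card (carrier A)"
    by (simp add: card_A card_PiE)
  ultimately have "inj_on lin ?E"
    using finite_R by (intro eq_card_imp_inj_on) (auto intro: finite_PiE)
  then have "restrict c {..<n} = restrict d {..<n}"
    using assms restr by (intro inj_onD[of lin ?E]) auto
  then show ?thesis
    using assms(4) by (metis restrict_apply' lessThan_iff)
qed

lemma lin_single:
  assumes "a \<in> carrier R" "k < n"
  shows "lin (\<lambda>i. if i = k then a else \<zero>\<^bsub>R\<^esub>) = a \<odot>\<^bsub>A\<^esub> x [^]\<^bsub>A\<^esub> k"
proof -
  have "lin (\<lambda>i. if i = k then a else \<zero>\<^bsub>R\<^esub>) =
      (\<Oplus>\<^bsub>A\<^esub>i\<in>{..<n}. if i = k then a \<odot>\<^bsub>A\<^esub> x [^]\<^bsub>A\<^esub> i else \<zero>\<^bsub>A\<^esub>)"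
    unfolding lin_def using assms by (intro A.finsum_cong') auto
  also have "\<dots> = a \<odot>\<^bsub>A\<^esub> x [^]\<^bsub>A\<^esub> k"
    using assms by (intro A.add.finprod_singleton_swap) auto
  finally show ?thesis .
qed

section \<open>Conjugation and the product of an element with its conjugate\<close>

abbreviation alt where "alt k \<equiv> (\<ominus>\<^bsub>R\<^esub> \<one>\<^bsub>R\<^esub>) [^]\<^bsub>R\<^esub> (k::nat)"

text \<open>Since \<open>cj g\<close> is the inverse of \<open>g\<close>, the conjugate of \<open>x = g - 1\<close> is \<open>- x g\<^sup>-\<^sup>1\<close>.\<close>

lemma cj_x_pow:
  assumes "k \<le> n"
  shows "cj (x [^]\<^bsub>A\<^esub> k) = alt k \<odot>\<^bsub>A\<^esub> (x [^]\<^bsub>A\<^esub> k \<otimes>\<^bsub>A\<^esub> g [^]\<^bsub>A\<^esub> (n - k))"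
proof -
  have "cj x \<otimes>\<^bsub>A\<^esub> g = \<ominus>\<^bsub>A\<^esub> x"
    by (simp add: x_def A.minus_eq A.l_distr cj_g A.l_minus A.minus_add A.a_comm)
  then have "cj x \<otimes>\<^bsub>A\<^esub> g = (\<ominus>\<^bsub>R\<^esub> \<one>\<^bsub>R\<^esub>) \<odot>\<^bsub>A\<^esub> x"
    by (simp add: smult_l_minus)
  then have "(cj x) [^]\<^bsub>A\<^esub> k \<otimes>\<^bsub>A\<^esub> g [^]\<^bsub>A\<^esub> k = ((\<ominus>\<^bsub>R\<^esub> \<one>\<^bsub>R\<^esub>) \<odot>\<^bsub>A\<^esub> x) [^]\<^bsub>A\<^esub> k"
    by (metis A.nat_pow_distrib cj.hom_closed g_closed x_closed)
  also have "\<dots> = alt k \<odot>\<^bsub>A\<^esub> x [^]\<^bsub>A\<^esub> k"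
    by (induction k) (auto simp: smult_mult_smult)
  \<comment> \<open>The factor \<open>g^(n-k)\<close> completes \<open>g^k\<close> to
    \<open>g^n = 1\<close>. No inverse of \<open>g\<close> remains, and the exponent on the right is
    a natural number, ready for binomial expansion.\<close>
  finally have "((cj x) [^]\<^bsub>A\<^esub> k \<otimes>\<^bsub>A\<^esub> g [^]\<^bsub>A\<^esub> k) \<otimes>\<^bsub>A\<^esub> g [^]\<^bsub>A\<^esub> (n - k) =
      alt k \<odot>\<^bsub>A\<^esub> (x [^]\<^bsub>A\<^esub> k \<otimes>\<^bsub>A\<^esub> g [^]\<^bsub>A\<^esub> (n - k))"
    by (simp add: smult_assoc2)
  moreover have "cj (x [^]\<^bsub>A\<^esub> k) = (cj x) [^]\<^bsub>A\<^esub> k"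
    by (induction k) auto
  ultimately show ?thesis
    using assms by (simp add: A.m_assoc A.nat_pow_mult g_pow_n)
qed

lemma cj_lin:
  assumes c: "c \<in> {..<n} \<rightarrow> carrier R"
  shows "cj (lin c) = (\<Oplus>\<^bsub>A\<^esub>k\<in>{..<n}. (alt k \<otimes>\<^bsub>R\<^esub> c k) \<odot>\<^bsub>A\<^esub> (x [^]\<^bsub>A\<^esub> k \<otimes>\<^bsub>A\<^esub> g [^]\<^bsub>A\<^esub> (n - k)))"
proof -
  have "cj (lin c) = (\<Oplus>\<^bsub>A\<^esub>k\<in>{..<n}. cj (c k \<odot>\<^bsub>A\<^esub> x [^]\<^bsub>A\<^esub> k))"
    unfolding lin_def using c by (subst cj.hom_finsum) (auto simp: comp_def Pi_iff)
  also have "\<dots> = (\<Oplus>\<^bsub>A\<^esub>k\<in>{..<n}. (alt k \<otimes>\<^bsub>R\<^esub> c k) \<odot>\<^bsub>A\<^esub> (x [^]\<^bsub>A\<^esub> k \<otimes>\<^bsub>A\<^esub> g [^]\<^bsub>A\<^esub> (n - k)))"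
  proof (rule A.finsum_cong')
    fix k assume k: "k \<in> {..<n}"
    then have ck: "c k \<in> carrier R" using c by auto
    then have "cj (c k \<odot>\<^bsub>A\<^esub> x [^]\<^bsub>A\<^esub> k) = c k \<odot>\<^bsub>A\<^esub> cj (x [^]\<^bsub>A\<^esub> k)"
      by (intro cj_smult) auto
    also have "cj (x [^]\<^bsub>A\<^esub> k) = alt k \<odot>\<^bsub>A\<^esub> (x [^]\<^bsub>A\<^esub> k \<otimes>\<^bsub>A\<^esub> g [^]\<^bsub>A\<^esub> (n - k))"
      using k by (intro cj_x_pow) auto
    also have "c k \<odot>\<^bsub>A\<^esub> \<dots> = (alt k \<otimes>\<^bsub>R\<^esub> c k) \<odot>\<^bsub>A\<^esub> (x [^]\<^bsub>A\<^esub> k \<otimes>\<^bsub>A\<^esub> g [^]\<^bsub>A\<^esub> (n - k))"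
      using ck by (simp add: R.m_comm[of _ "c k"] smult_assoc1)
    finally show "cj (c k \<odot>\<^bsub>A\<^esub> x [^]\<^bsub>A\<^esub> k) =
        (alt k \<otimes>\<^bsub>R\<^esub> c k) \<odot>\<^bsub>A\<^esub> (x [^]\<^bsub>A\<^esub> k \<otimes>\<^bsub>A\<^esub> g [^]\<^bsub>A\<^esub> (n - k))" .
  qed (use c in \<open>auto simp: Pi_iff\<close>)
  finally show ?thesis .
qed

text \<open>A contribution to the coefficient of \<open>x^i\<close> in the product:
  \<open>x^k\<close> comes from the conjugate, \<open>x^(j-k)\<close> from the other factor, and the
  remaining degree \<open>i - j\<close> from expanding \<open>g^(n-k)\<close>.\<close>

definition norm_term where
  "norm_term c i j k =
    alt k \<otimes>\<^bsub>R\<^esub> ([((n - k) choose (i - j))] \<cdot>\<^bsub>R\<^esub> \<one>\<^bsub>R\<^esub>) \<otimes>\<^bsub>R\<^esub> c k \<otimes>\<^bsub>R\<^esub> c (j - k)"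

definition norm_coeff where
  "norm_coeff c i = (\<Oplus>\<^bsub>R\<^esub>j\<in>{..i}. \<Oplus>\<^bsub>R\<^esub>k\<in>{..j}. norm_term c i j k)"

lemma norm_term_closed:
  "c \<in> {..<n} \<rightarrow> carrier R \<Longrightarrow> k \<le> j \<Longrightarrow> j < n \<Longrightarrow> norm_term c i j k \<in> carrier R"
  by (auto simp: norm_term_def Pi_iff)

lemma norm_coeff_closed: "c \<in> {..<n} \<rightarrow> carrier R \<Longrightarrow> i < n \<Longrightarrow> norm_coeff c i \<in> carrier R"
  unfolding norm_coeff_def by (auto intro!: R.finsum_closed norm_term_closed)

text \<open>The power of \<open>g\<close> contributed by \<open>cj\<close> is kept as a coefficient while the powers
  of \<open>x\<close> are collected, and expanded in powers of \<open>x\<close> only afterwards.\<close>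

lemma lin_mult_cj_lin:
  assumes c: "c \<in> {..<n} \<rightarrow> carrier R"
  shows "lin c \<otimes>\<^bsub>A\<^esub> cj (lin c) = lin (norm_coeff c)"
proof -
  note xn = A.finsum_powers_collect[OF x_closed x_pow_n]
  have ck: "c k \<in> carrier R" if "k < n" for k using c that by auto
  let ?a = "\<lambda>k l. alt k \<otimes>\<^bsub>R\<^esub> c k \<otimes>\<^bsub>R\<^esub> c l"
  let ?G = "\<lambda>k. g [^]\<^bsub>A\<^esub> (n - k)"
  have "lin c \<otimes>\<^bsub>A\<^esub> cj (lin c) = cj (lin c) \<otimes>\<^bsub>A\<^esub> lin c"
    by (intro A.m_comm cj.hom_closed lin_closed c)
  also have "\<dots> = (\<Oplus>\<^bsub>A\<^esub>k\<in>{..<n}. (alt k \<otimes>\<^bsub>R\<^esub> c k) \<odot>\<^bsub>A\<^esub> (x [^]\<^bsub>A\<^esub> k \<otimes>\<^bsub>A\<^esub> ?G k) \<otimes>\<^bsub>A\<^esub> lin c)"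
    unfolding cj_lin[OF c] by (intro A.finsum_ldistr) (auto simp: ck lin_closed c)
  also have "\<dots> = (\<Oplus>\<^bsub>A\<^esub>k\<in>{..<n}. \<Oplus>\<^bsub>A\<^esub>l\<in>{..<n}. (?a k l \<odot>\<^bsub>A\<^esub> ?G k) \<otimes>\<^bsub>A\<^esub> x [^]\<^bsub>A\<^esub> (k + l))"
  proof (rule A.finsum_cong')
    fix k assume k: "k \<in> {..<n}"
    have "(alt k \<otimes>\<^bsub>R\<^esub> c k) \<odot>\<^bsub>A\<^esub> (x [^]\<^bsub>A\<^esub> k \<otimes>\<^bsub>A\<^esub> ?G k) \<otimes>\<^bsub>A\<^esub> lin c =
        (\<Oplus>\<^bsub>A\<^esub>l\<in>{..<n}. (alt k \<otimes>\<^bsub>R\<^esub> c k) \<odot>\<^bsub>A\<^esub> (x [^]\<^bsub>A\<^esub> k \<otimes>\<^bsub>A\<^esub> ?G k) \<otimes>\<^bsub>A\<^esub> (c l \<odot>\<^bsub>A\<^esub> x [^]\<^bsub>A\<^esub> l))"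
      unfolding lin_def using k by (intro A.finsum_rdistr) (auto simp: ck)
    also have "\<dots> = (\<Oplus>\<^bsub>A\<^esub>l\<in>{..<n}. (?a k l \<odot>\<^bsub>A\<^esub> ?G k) \<otimes>\<^bsub>A\<^esub> x [^]\<^bsub>A\<^esub> (k + l))"
    proof (rule A.finsum_cong')
      fix l assume l: "l \<in> {..<n}"
      have "(alt k \<otimes>\<^bsub>R\<^esub> c k) \<odot>\<^bsub>A\<^esub> (x [^]\<^bsub>A\<^esub> k \<otimes>\<^bsub>A\<^esub> ?G k) \<otimes>\<^bsub>A\<^esub> (c l \<odot>\<^bsub>A\<^esub> x [^]\<^bsub>A\<^esub> l) =
          ?a k l \<odot>\<^bsub>A\<^esub> ((x [^]\<^bsub>A\<^esub> k \<otimes>\<^bsub>A\<^esub> ?G k) \<otimes>\<^bsub>A\<^esub> x [^]\<^bsub>A\<^esub> l)"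
        using k l by (intro smult_mult_smult) (auto simp: ck)
      also have "(x [^]\<^bsub>A\<^esub> k \<otimes>\<^bsub>A\<^esub> ?G k) \<otimes>\<^bsub>A\<^esub> x [^]\<^bsub>A\<^esub> l = ?G k \<otimes>\<^bsub>A\<^esub> x [^]\<^bsub>A\<^esub> (k + l)"
        by (simp add: A.nat_pow_mult[symmetric] A.m_ac)
      also have "?a k l \<odot>\<^bsub>A\<^esub> \<dots> = (?a k l \<odot>\<^bsub>A\<^esub> ?G k) \<otimes>\<^bsub>A\<^esub> x [^]\<^bsub>A\<^esub> (k + l)"
        using k l by (intro smult_assoc2[symmetric]) (auto simp: ck)
      finally show "(alt k \<otimes>\<^bsub>R\<^esub> c k) \<odot>\<^bsub>A\<^esub> (x [^]\<^bsub>A\<^esub> k \<otimes>\<^bsub>A\<^esub> ?G k) \<otimes>\<^bsub>A\<^esub> (c l \<odot>\<^bsub>A\<^esub> x [^]\<^bsub>A\<^esub> l) =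
          (?a k l \<odot>\<^bsub>A\<^esub> ?G k) \<otimes>\<^bsub>A\<^esub> x [^]\<^bsub>A\<^esub> (k + l)" .
    qed (use k in \<open>auto simp: ck\<close>)
    finally show "(alt k \<otimes>\<^bsub>R\<^esub> c k) \<odot>\<^bsub>A\<^esub> (x [^]\<^bsub>A\<^esub> k \<otimes>\<^bsub>A\<^esub> ?G k) \<otimes>\<^bsub>A\<^esub> lin c =
      (\<Oplus>\<^bsub>A\<^esub>l\<in>{..<n}. (?a k l \<odot>\<^bsub>A\<^esub> ?G k) \<otimes>\<^bsub>A\<^esub> x [^]\<^bsub>A\<^esub> (k + l))" .
  qed (auto simp: ck intro!: A.finsum_closed)
  also have "\<dots> = (\<Oplus>\<^bsub>A\<^esub>j\<in>{..<n}. (\<Oplus>\<^bsub>A\<^esub>k\<in>{..j}. ?a k (j - k) \<odot>\<^bsub>A\<^esub> ?G k) \<otimes>\<^bsub>A\<^esub> x [^]\<^bsub>A\<^esub> j)"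
    by (intro xn) (auto simp: ck)
  \<comment> \<open>Each coefficient is expanded with inner degree \<open>r\<close>, so the total
    degree is \<open>j + r\<close>. The scalars are written as multiples of one because the
    collecting lemma takes coefficients in \<open>A\<close>.\<close>
  also have "\<dots> = (\<Oplus>\<^bsub>A\<^esub>j\<in>{..<n}. \<Oplus>\<^bsub>A\<^esub>r\<in>{..<n}.
      ((\<Oplus>\<^bsub>R\<^esub>k\<in>{..j}. norm_term c (j + r) j k) \<odot>\<^bsub>A\<^esub> \<one>\<^bsub>A\<^esub>) \<otimes>\<^bsub>A\<^esub> x [^]\<^bsub>A\<^esub> (j + r))"
  proof (rule A.finsum_cong')
    fix j assume j: "j \<in> {..<n}"
    let ?b = "\<lambda>k r. norm_term c (j + r) j k"
    have b: "?b k r \<in> carrier R" if "k \<le> j" for k r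
      using that j by (intro norm_term_closed c) auto
    have "(\<Oplus>\<^bsub>A\<^esub>k\<in>{..j}. ?a k (j - k) \<odot>\<^bsub>A\<^esub> ?G k) =
        (\<Oplus>\<^bsub>A\<^esub>k\<in>{..j}. \<Oplus>\<^bsub>A\<^esub>r\<in>{..<n}. ?b k r \<odot>\<^bsub>A\<^esub> x [^]\<^bsub>A\<^esub> r)"
    proof (rule A.finsum_cong')
      fix k assume "k \<in> {..j}"
      then have kj: "c k \<in> carrier R" "c (j - k) \<in> carrier R" "k \<le> j"
        using j by (auto simp: ck)
      have "?a k (j - k) \<odot>\<^bsub>A\<^esub> ?G k = (\<Oplus>\<^bsub>A\<^esub>r\<in>{..<n}. ?a k (j - k) \<odot>\<^bsub>A\<^esub>
          (([((n - k) choose r)] \<cdot>\<^bsub>R\<^esub> \<one>\<^bsub>R\<^esub>) \<odot>\<^bsub>A\<^esub> x [^]\<^bsub>A\<^esub> r))"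
        unfolding g_pow_expand using kj by (intro smult_finsum_right) auto
      also have "\<dots> = (\<Oplus>\<^bsub>A\<^esub>r\<in>{..<n}. ?b k r \<odot>\<^bsub>A\<^esub> x [^]\<^bsub>A\<^esub> r)"
      proof (rule A.finsum_cong')
        fix r
        have "?b k r = ?a k (j - k) \<otimes>\<^bsub>R\<^esub> ([((n - k) choose r)] \<cdot>\<^bsub>R\<^esub> \<one>\<^bsub>R\<^esub>)"
          using kj by (simp add: norm_term_def R.m_ac)
        then show "?a k (j - k) \<odot>\<^bsub>A\<^esub> (([((n - k) choose r)] \<cdot>\<^bsub>R\<^esub> \<one>\<^bsub>R\<^esub>) \<odot>\<^bsub>A\<^esub> x [^]\<^bsub>A\<^esub> r) =
            ?b k r \<odot>\<^bsub>A\<^esub> x [^]\<^bsub>A\<^esub> r"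
          using kj by (simp only:) (intro smult_assoc1[symmetric], auto)
      qed (use kj b in auto)
      finally show "?a k (j - k) \<odot>\<^bsub>A\<^esub> ?G k = (\<Oplus>\<^bsub>A\<^esub>r\<in>{..<n}. ?b k r \<odot>\<^bsub>A\<^esub> x [^]\<^bsub>A\<^esub> r)" .
    qed (auto simp: b intro!: A.finsum_closed)
    also have "\<dots> = (\<Oplus>\<^bsub>A\<^esub>r\<in>{..<n}. \<Oplus>\<^bsub>A\<^esub>k\<in>{..j}. ?b k r \<odot>\<^bsub>A\<^esub> x [^]\<^bsub>A\<^esub> r)"
      by (intro A.finsum_swap) (auto simp: b)
    also have "\<dots> = (\<Oplus>\<^bsub>A\<^esub>r\<in>{..<n}. (\<Oplus>\<^bsub>R\<^esub>k\<in>{..j}. ?b k r) \<odot>\<^bsub>A\<^esub> x [^]\<^bsub>A\<^esub> r)"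
    proof (rule A.finsum_cong')
      fix r
      show "(\<Oplus>\<^bsub>A\<^esub>k\<in>{..j}. ?b k r \<odot>\<^bsub>A\<^esub> x [^]\<^bsub>A\<^esub> r) = (\<Oplus>\<^bsub>R\<^esub>k\<in>{..j}. ?b k r) \<odot>\<^bsub>A\<^esub> x [^]\<^bsub>A\<^esub> r"
        by (intro smult_finsum_left[symmetric]) (auto simp: b)
    qed (auto simp: b intro!: smult_closed R.finsum_closed)
    finally have "(\<Oplus>\<^bsub>A\<^esub>k\<in>{..j}. ?a k (j - k) \<odot>\<^bsub>A\<^esub> ?G k) \<otimes>\<^bsub>A\<^esub> x [^]\<^bsub>A\<^esub> j =
        (\<Oplus>\<^bsub>A\<^esub>r\<in>{..<n}. (\<Oplus>\<^bsub>R\<^esub>k\<in>{..j}. ?b k r) \<odot>\<^bsub>A\<^esub> x [^]\<^bsub>A\<^esub> r \<otimes>\<^bsub>A\<^esub> x [^]\<^bsub>A\<^esub> j)"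
      by (simp add: b A.finsum_ldistr Pi_def R.finsum_closed)
    also have "\<dots> = (\<Oplus>\<^bsub>A\<^esub>r\<in>{..<n}. ((\<Oplus>\<^bsub>R\<^esub>k\<in>{..j}. ?b k r) \<odot>\<^bsub>A\<^esub> \<one>\<^bsub>A\<^esub>) \<otimes>\<^bsub>A\<^esub> x [^]\<^bsub>A\<^esub> (j + r))"
    proof (rule A.finsum_cong')
      fix r
      have "(\<Oplus>\<^bsub>R\<^esub>k\<in>{..j}. ?b k r) \<in> carrier R"
        by (intro R.finsum_closed) (auto simp: b)
      then show "(\<Oplus>\<^bsub>R\<^esub>k\<in>{..j}. ?b k r) \<odot>\<^bsub>A\<^esub> x [^]\<^bsub>A\<^esub> r \<otimes>\<^bsub>A\<^esub> x [^]\<^bsub>A\<^esub> j =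
          ((\<Oplus>\<^bsub>R\<^esub>k\<in>{..j}. ?b k r) \<odot>\<^bsub>A\<^esub> \<one>\<^bsub>A\<^esub>) \<otimes>\<^bsub>A\<^esub> x [^]\<^bsub>A\<^esub> (j + r)"
        by (simp add: smult_assoc2 A.nat_pow_mult add.commute)
    qed (auto simp: b intro!: smult_closed R.finsum_closed A.m_closed)
    finally show "(\<Oplus>\<^bsub>A\<^esub>k\<in>{..j}. ?a k (j - k) \<odot>\<^bsub>A\<^esub> ?G k) \<otimes>\<^bsub>A\<^esub> x [^]\<^bsub>A\<^esub> j =
      (\<Oplus>\<^bsub>A\<^esub>r\<in>{..<n}. ((\<Oplus>\<^bsub>R\<^esub>k\<in>{..j}. ?b k r) \<odot>\<^bsub>A\<^esub> \<one>\<^bsub>A\<^esub>) \<otimes>\<^bsub>A\<^esub> x [^]\<^bsub>A\<^esub> (j + r))" .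
  qed (auto intro!: A.finsum_closed smult_closed R.finsum_closed A.m_closed norm_term_closed c)
  \<comment> \<open>The second collection sets \<open>i = j + r\<close>, which makes
    \<open>i - j\<close> the lower index of the binomial coefficient.\<close>
  also have "\<dots> = (\<Oplus>\<^bsub>A\<^esub>i\<in>{..<n}. (\<Oplus>\<^bsub>A\<^esub>j\<in>{..i}.
      (\<Oplus>\<^bsub>R\<^esub>k\<in>{..j}. norm_term c (j + (i - j)) j k) \<odot>\<^bsub>A\<^esub> \<one>\<^bsub>A\<^esub>) \<otimes>\<^bsub>A\<^esub> x [^]\<^bsub>A\<^esub> i)"
    by (intro xn) (auto intro!: smult_closed R.finsum_closed norm_term_closed c)
  also have "\<dots> = lin (norm_coeff c)"
    unfolding lin_def
  proof (rule A.finsum_cong')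
    fix i assume i: "i \<in> {..<n}"
    have "(\<Oplus>\<^bsub>A\<^esub>j\<in>{..i}. (\<Oplus>\<^bsub>R\<^esub>k\<in>{..j}. norm_term c (j + (i - j)) j k) \<odot>\<^bsub>A\<^esub> \<one>\<^bsub>A\<^esub>) =
        (\<Oplus>\<^bsub>A\<^esub>j\<in>{..i}. (\<Oplus>\<^bsub>R\<^esub>k\<in>{..j}. norm_term c i j k) \<odot>\<^bsub>A\<^esub> \<one>\<^bsub>A\<^esub>)"
      using i by (intro A.finsum_cong') (auto intro!: smult_closed R.finsum_closed norm_term_closed c)
    also have "\<dots> = norm_coeff c i \<odot>\<^bsub>A\<^esub> \<one>\<^bsub>A\<^esub>"
      unfolding norm_coeff_def using i
      by (intro smult_finsum_left[symmetric]) (auto intro!: R.finsum_closed norm_term_closed c)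
    finally show "(\<Oplus>\<^bsub>A\<^esub>j\<in>{..i}. (\<Oplus>\<^bsub>R\<^esub>k\<in>{..j}. norm_term c (j + (i - j)) j k) \<odot>\<^bsub>A\<^esub> \<one>\<^bsub>A\<^esub>) \<otimes>\<^bsub>A\<^esub>
        x [^]\<^bsub>A\<^esub> i = norm_coeff c i \<odot>\<^bsub>A\<^esub> x [^]\<^bsub>A\<^esub> i"
      using i norm_coeff_closed[OF c] by (simp add: smult_assoc2)
  qed (auto simp: norm_coeff_closed[OF c])
  finally show ?thesis .
qed

text \<open>Write \<open>p = 2 * k + 1\<close>. Since twice \<open>a\<close> is zero, the
  \<open>p\<close>-fold multiple of \<open>a\<close> is \<open>a\<close>, and it vanishes by the
  characteristic.\<close>

lemma double_eq_zero_imp: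
  assumes a: "a \<in> carrier R" "a = \<ominus>\<^bsub>R\<^esub> a"
  shows "a = \<zero>\<^bsub>R\<^esub>"
proof -
  obtain k where k: "p = 2 * k + 1"
    using odd_p by (auto elim: oddE)
  have "[(2::nat)] \<cdot>\<^bsub>R\<^esub> a = a \<oplus>\<^bsub>R\<^esub> a"
    using a(1) by (simp add: numeral_2_eq_2)
  also have "\<dots> = \<zero>\<^bsub>R\<^esub>"
    using a by (metis R.r_neg)
  finally have two: "[(2::nat)] \<cdot>\<^bsub>R\<^esub> a = \<zero>\<^bsub>R\<^esub>" .
  have "[p] \<cdot>\<^bsub>R\<^esub> a = [(2 * k)] \<cdot>\<^bsub>R\<^esub> a \<oplus>\<^bsub>R\<^esub> a"
    using a(1) by (simp add: k)
  also have "[(2 * k)] \<cdot>\<^bsub>R\<^esub> a = \<zero>\<^bsub>R\<^esub>"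
    using a(1) two by (simp add: R.add.nat_pow_pow[symmetric])
  finally show ?thesis
    using a(1) R.add_pow_multiple_eq_zero[OF char_R, of p a] by simp
qed

text \<open>An element fixed by \<open>cj\<close> has no leading term of odd degree above its constant term,
  because \<open>cj\<close> changes the sign of \<open>x\<^sup>i\<close> modulo higher powers of \<open>x\<close>. Multiplication by
  \<open>x\<^sup>n\<^sup>-\<^sup>1\<^sup>-\<^sup>i\<close> isolates the leading term.\<close>

lemma odd_coeff_zero:
  assumes w: "w \<in> {..<n} \<rightarrow> carrier R" and inv: "cj (lin w) = lin w"
    and i: "i < n" "odd i" and below: "\<And>k. 0 < k \<Longrightarrow> k < i \<Longrightarrow> w k = \<zero>\<^bsub>R\<^esub>"
  shows "w i = \<zero>\<^bsub>R\<^esub>"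
proof -
  have wk: "w k \<in> carrier R" if "k < n" for k using w that by auto
  have i0: "i \<noteq> 0" using i(2) by (cases i) auto
  define y where "y = x [^]\<^bsub>A\<^esub> (n - 1 - i)"
  have y [simp]: "y \<in> carrier A"
    by (simp add: y_def)
  have high: "x [^]\<^bsub>A\<^esub> k \<otimes>\<^bsub>A\<^esub> y = \<zero>\<^bsub>A\<^esub>" if "i < k" for k
    using that i by (simp add: y_def A.nat_pow_mult x_pow_ge)
  have top: "x [^]\<^bsub>A\<^esub> i \<otimes>\<^bsub>A\<^esub> y = x [^]\<^bsub>A\<^esub> (n - 1)"
    using i by (simp add: y_def A.nat_pow_mult)
  \<comment> \<open>One more factor \<open>x\<close> would give \<open>x^n = 0\<close>, so
    multiplication by \<open>g = x + 1\<close> fixes \<open>x^(n-1)\<close>. The powers of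
    \<open>g\<close> produced by conjugation thus disappear in top degree.\<close>
  have top_g: "x [^]\<^bsub>A\<^esub> (n - 1) \<otimes>\<^bsub>A\<^esub> g [^]\<^bsub>A\<^esub> (k::nat) = x [^]\<^bsub>A\<^esub> (n - 1)" for k
  proof (induction k)
    case (Suc k)
    have "x [^]\<^bsub>A\<^esub> (n - 1) \<otimes>\<^bsub>A\<^esub> x = \<zero>\<^bsub>A\<^esub>"
      using n_pos x_pow_n A.nat_pow_Suc[of x "n - 1"] by simp
    then have "x [^]\<^bsub>A\<^esub> (n - 1) \<otimes>\<^bsub>A\<^esub> g = x [^]\<^bsub>A\<^esub> (n - 1)"
      using A.r_distr[of x "\<one>\<^bsub>A\<^esub>" "x [^]\<^bsub>A\<^esub> (n - 1)"] by (simp add: x_plus_one)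
    then show ?case
      using Suc by (simp add: A.m_assoc[symmetric])
  qed simp
  \<comment> \<open>In both expansions below, terms strictly between \<open>0\<close> and
    \<open>i\<close> vanish by hypothesis and those above \<open>i\<close> by nilpotency. The
    constant terms agree and cancel at the end.\<close>
  have collapse: "(\<Oplus>\<^bsub>A\<^esub>k\<in>{..<n}. f k) = f i \<oplus>\<^bsub>A\<^esub> f 0"
    if f: "\<And>k. k < n \<Longrightarrow> f k \<in> carrier A" "\<And>k. k < n \<Longrightarrow> k \<noteq> 0 \<Longrightarrow> k \<noteq> i \<Longrightarrow> f k = \<zero>\<^bsub>A\<^esub>" for f
  proof -
    have "(\<Oplus>\<^bsub>A\<^esub>k\<in>{..<n}. f k) = (\<Oplus>\<^bsub>A\<^esub>k\<in>{i, 0}. f k)"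
      using f i n_pos by (intro A.add.finprod_mono_neutral_cong_right) auto
    then show ?thesis
      using f i i0 n_pos by simp
  qed
  have "lin w \<otimes>\<^bsub>A\<^esub> y = (\<Oplus>\<^bsub>A\<^esub>k\<in>{..<n}. w k \<odot>\<^bsub>A\<^esub> (x [^]\<^bsub>A\<^esub> k \<otimes>\<^bsub>A\<^esub> y))"
    unfolding lin_def
    by (subst A.finsum_ldistr) (auto simp: wk smult_assoc2 intro!: A.finsum_cong')
  also have "\<dots> = w i \<odot>\<^bsub>A\<^esub> x [^]\<^bsub>A\<^esub> (n - 1) \<oplus>\<^bsub>A\<^esub> w 0 \<odot>\<^bsub>A\<^esub> y"
  proof (subst collapse)
    fix k assume "k < n" "k \<noteq> 0" "k \<noteq> i"
    then show "w k \<odot>\<^bsub>A\<^esub> (x [^]\<^bsub>A\<^esub> k \<otimes>\<^bsub>A\<^esub> y) = \<zero>\<^bsub>A\<^esub>"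
      by (cases "k < i") (auto simp: below high wk)
  qed (auto simp: wk top)
  finally have 1: "lin w \<otimes>\<^bsub>A\<^esub> y = w i \<odot>\<^bsub>A\<^esub> x [^]\<^bsub>A\<^esub> (n - 1) \<oplus>\<^bsub>A\<^esub> w 0 \<odot>\<^bsub>A\<^esub> y" .
  \<comment> \<open>The factors are grouped so that \<open>x^k\<close> meets \<open>y\<close> first,
    where \<open>high\<close> and \<open>top\<close> apply.\<close>
  let ?h = "\<lambda>k. g [^]\<^bsub>A\<^esub> (n - k) \<otimes>\<^bsub>A\<^esub> (x [^]\<^bsub>A\<^esub> k \<otimes>\<^bsub>A\<^esub> y)"
  have alt_i: "alt i = \<ominus>\<^bsub>R\<^esub> \<one>\<^bsub>R\<^esub>"
  proof -
    obtain l where l: "i = 2 * l + 1" using i(2) by (auto elim: oddE)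
    have "alt 2 = \<one>\<^bsub>R\<^esub>"
      by (simp add: numeral_2_eq_2 R.l_minus)
    then have "alt (2 * l) = \<one>\<^bsub>R\<^esub>"
      by (simp add: R.nat_pow_pow[symmetric])
    then show ?thesis
      by (simp add: l)
  qed
  have "cj (lin w) \<otimes>\<^bsub>A\<^esub> y = (\<Oplus>\<^bsub>A\<^esub>k\<in>{..<n}. (alt k \<otimes>\<^bsub>R\<^esub> w k) \<odot>\<^bsub>A\<^esub> ?h k)"
  proof -
    have "cj (lin w) \<otimes>\<^bsub>A\<^esub> y = (\<Oplus>\<^bsub>A\<^esub>k\<in>{..<n}.
        (alt k \<otimes>\<^bsub>R\<^esub> w k) \<odot>\<^bsub>A\<^esub> (x [^]\<^bsub>A\<^esub> k \<otimes>\<^bsub>A\<^esub> g [^]\<^bsub>A\<^esub> (n - k)) \<otimes>\<^bsub>A\<^esub> y)"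
      unfolding cj_lin[OF w] by (intro A.finsum_ldistr) (auto simp: wk)
    also have "\<dots> = (\<Oplus>\<^bsub>A\<^esub>k\<in>{..<n}. (alt k \<otimes>\<^bsub>R\<^esub> w k) \<odot>\<^bsub>A\<^esub> ?h k)"
    proof (rule A.finsum_cong')
      fix k assume k: "k \<in> {..<n}"
      have "x [^]\<^bsub>A\<^esub> k \<otimes>\<^bsub>A\<^esub> g [^]\<^bsub>A\<^esub> (n - k) \<otimes>\<^bsub>A\<^esub> y = ?h k"
        by (simp add: A.m_ac)
      then show "(alt k \<otimes>\<^bsub>R\<^esub> w k) \<odot>\<^bsub>A\<^esub> (x [^]\<^bsub>A\<^esub> k \<otimes>\<^bsub>A\<^esub> g [^]\<^bsub>A\<^esub> (n - k)) \<otimes>\<^bsub>A\<^esub> y =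
          (alt k \<otimes>\<^bsub>R\<^esub> w k) \<odot>\<^bsub>A\<^esub> ?h k"
        using k by (simp add: smult_assoc2 wk)
    qed (auto simp: wk)
    finally show ?thesis .
  qed
  also have "\<dots> = (\<ominus>\<^bsub>R\<^esub> w i) \<odot>\<^bsub>A\<^esub> x [^]\<^bsub>A\<^esub> (n - 1) \<oplus>\<^bsub>A\<^esub> w 0 \<odot>\<^bsub>A\<^esub> y"
  proof (subst collapse)
    fix k assume "k < n" "k \<noteq> 0" "k \<noteq> i"
    then show "(alt k \<otimes>\<^bsub>R\<^esub> w k) \<odot>\<^bsub>A\<^esub> ?h k = \<zero>\<^bsub>A\<^esub>"
      by (cases "k < i") (auto simp: below high wk)
  next
    have "?h i = x [^]\<^bsub>A\<^esub> (n - 1)"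
      unfolding top by (subst A.m_comm) (auto simp: top_g[simplified])
    moreover have "?h 0 = y"
      by (simp add: g_pow_n)
    moreover have "alt i \<otimes>\<^bsub>R\<^esub> w i = \<ominus>\<^bsub>R\<^esub> w i"
      using i by (simp add: alt_i wk R.l_minus)
    moreover have "alt 0 \<otimes>\<^bsub>R\<^esub> w 0 = w 0"
      using n_pos by (simp add: wk)
    ultimately show "(alt i \<otimes>\<^bsub>R\<^esub> w i) \<odot>\<^bsub>A\<^esub> ?h i \<oplus>\<^bsub>A\<^esub> (alt 0 \<otimes>\<^bsub>R\<^esub> w 0) \<odot>\<^bsub>A\<^esub> ?h 0 =
        (\<ominus>\<^bsub>R\<^esub> w i) \<odot>\<^bsub>A\<^esub> x [^]\<^bsub>A\<^esub> (n - 1) \<oplus>\<^bsub>A\<^esub> w 0 \<odot>\<^bsub>A\<^esub> y"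
      by (simp only:)
  qed (auto simp: wk)
  finally have "w i \<odot>\<^bsub>A\<^esub> x [^]\<^bsub>A\<^esub> (n - 1) \<oplus>\<^bsub>A\<^esub> w 0 \<odot>\<^bsub>A\<^esub> y =
      (\<ominus>\<^bsub>R\<^esub> w i) \<odot>\<^bsub>A\<^esub> x [^]\<^bsub>A\<^esub> (n - 1) \<oplus>\<^bsub>A\<^esub> w 0 \<odot>\<^bsub>A\<^esub> y"
    using 1 inv by simp
  then have "w i \<odot>\<^bsub>A\<^esub> x [^]\<^bsub>A\<^esub> (n - 1) = (\<ominus>\<^bsub>R\<^esub> w i) \<odot>\<^bsub>A\<^esub> x [^]\<^bsub>A\<^esub> (n - 1)"
    using i n_pos by (subst (asm) A.add.right_cancel) (auto simp: wk)
  \<comment> \<open>Both sides are written as values of \<open>lin\<close>, so that uniqueness of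
    coordinates turns the equation into one between scalars.\<close>
  then have "lin (\<lambda>k. if k = n - 1 then w i else \<zero>\<^bsub>R\<^esub>) =
      lin (\<lambda>k. if k = n - 1 then \<ominus>\<^bsub>R\<^esub> w i else \<zero>\<^bsub>R\<^esub>)"
    using i by (simp add: lin_single wk)
  then have "w i = \<ominus>\<^bsub>R\<^esub> w i"
    using lin_inj[of "\<lambda>k. if k = n - 1 then w i else \<zero>\<^bsub>R\<^esub>"
        "\<lambda>k. if k = n - 1 then \<ominus>\<^bsub>R\<^esub> w i else \<zero>\<^bsub>R\<^esub>" "n - 1"] i
    by (auto simp: wk)
  then show ?thesis
    using i by (intro double_eq_zero_imp) (auto simp: wk)
qed

section \<open>Coefficient conditions for unitary elements\<close>

lemma norm_coeff_0: "c \<in> {..<n} \<rightarrow> carrier R \<Longrightarrow> norm_coeff c 0 = c 0 \<otimes>\<^bsub>R\<^esub> c 0"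
  using n_pos by (simp add: norm_coeff_def norm_term_def Pi_iff)

lemma norm_coeff_pos:
  assumes c: "c \<in> {..<n} \<rightarrow> carrier R" and i: "0 < i" "i < n"
  shows "norm_coeff c i = (\<Oplus>\<^bsub>R\<^esub>j\<in>{1..i}. \<Oplus>\<^bsub>R\<^esub>k\<in>{0..j}. norm_term c i j k)"
proof -
  have c0: "c 0 \<in> carrier R" using c n_pos by auto
  have "p dvd (n choose i)"
    unfolding n_def using i by (intro prime_dvd_prime_power_choose prime_p) (auto simp: n_def)
  then have "norm_term c i 0 0 = \<zero>\<^bsub>R\<^esub>"
    using R.add_pow_multiple_eq_zero[OF char_R, of "n choose i" "\<one>\<^bsub>R\<^esub>"] c0
    by (simp add: norm_term_def)
  then have "norm_coeff c i = (\<Oplus>\<^bsub>R\<^esub>j\<in>{1..i}. \<Oplus>\<^bsub>R\<^esub>k\<in>{..j}. norm_term c i j k)"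
    unfolding norm_coeff_def using i norm_term_closed[OF c]
    by (intro R.add.finprod_mono_neutral_cong_right) (auto intro!: R.finsum_closed simp: not_le)
  then show ?thesis
    by (simp add: atMost_atLeast0)
qed

lemma unitary_lin_iff:
  assumes c: "c \<in> {..<n} \<rightarrow> carrier R"
  shows "lin c \<otimes>\<^bsub>A\<^esub> cj (lin c) = \<one>\<^bsub>A\<^esub> \<longleftrightarrow>
    (c 0 = \<one>\<^bsub>R\<^esub> \<or> c 0 = \<ominus>\<^bsub>R\<^esub> \<one>\<^bsub>R\<^esub>) \<and> (\<forall>i\<in>{1..(n - 1) div 2}. norm_coeff c (2 * i) = \<zero>\<^bsub>R\<^esub>)"
    (is "?L \<longleftrightarrow> ?R")
proof -
  let ?w = "norm_coeff c"
  let ?e = "\<lambda>i. if i = 0 then \<one>\<^bsub>R\<^esub> else \<zero>\<^bsub>R\<^esub>"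
  have w: "?w \<in> {..<n} \<rightarrow> carrier R"
    using norm_coeff_closed[OF c] by auto
  have c0: "c 0 \<in> carrier R" using c n_pos by auto
  have e: "lin ?e = \<one>\<^bsub>A\<^esub>"
    using n_pos by (simp add: lin_single)
  have w0: "?w 0 = \<one>\<^bsub>R\<^esub> \<longleftrightarrow> c 0 = \<one>\<^bsub>R\<^esub> \<or> c 0 = \<ominus>\<^bsub>R\<^esub> \<one>\<^bsub>R\<^esub>"
    unfolding norm_coeff_0[OF c]
  proof
    assume "c 0 \<otimes>\<^bsub>R\<^esub> c 0 = \<one>\<^bsub>R\<^esub>"
    then show "c 0 = \<one>\<^bsub>R\<^esub> \<or> c 0 = \<ominus>\<^bsub>R\<^esub> \<one>\<^bsub>R\<^esub>"
      by (rule R.square_eq_one[OF c0])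
  next
    assume "c 0 = \<one>\<^bsub>R\<^esub> \<or> c 0 = \<ominus>\<^bsub>R\<^esub> \<one>\<^bsub>R\<^esub>"
    then show "c 0 \<otimes>\<^bsub>R\<^esub> c 0 = \<one>\<^bsub>R\<^esub>"
      by (elim disjE) (simp_all add: R.l_minus)
  qed
  have "?L \<longleftrightarrow> lin ?w = lin ?e"
    by (simp only: lin_mult_cj_lin[OF c] e)
  also have "\<dots> \<longleftrightarrow> (\<forall>i<n. ?w i = ?e i)"
  proof
    assume eq: "lin ?w = lin ?e"
    have "?e \<in> {..<n} \<rightarrow> carrier R" by simp
    then show "\<forall>i<n. ?w i = ?e i"
      using lin_inj[OF w _ eq] by blast
  next
    assume "\<forall>i<n. ?w i = ?e i"
    then show "lin ?w = lin ?e"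
      by (intro lin_cong) auto
  qed
  also have "\<dots> \<longleftrightarrow> ?R"
  proof
    assume *: "\<forall>i<n. ?w i = ?e i"
    then have "?w 0 = \<one>\<^bsub>R\<^esub>"
      using n_pos by simp
    moreover have "?w (2 * i) = \<zero>\<^bsub>R\<^esub>" if i: "i \<in> {1..(n - 1) div 2}" for i
    proof -
      have "2 * i < n" "2 * i \<noteq> 0"
        using i n_pos by auto
      then show ?thesis
        using * by simp
    qed
    ultimately show ?R
      using w0 by blast
  next
    assume R: ?R
    \<comment> \<open>As an involution, conjugation exchanges the two factors, so the product is
      fixed and \<open>odd_coeff_zero\<close> applies to it.\<close>
    have "cj (lin ?w) = cj (lin c) \<otimes>\<^bsub>A\<^esub> lin c"
      unfolding lin_mult_cj_lin[OF c, symmetric] using lin_closed[OF c] by (simp add: cj_cj)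
    also have "\<dots> = lin c \<otimes>\<^bsub>A\<^esub> cj (lin c)"
      using lin_closed[OF c] by (intro A.m_comm) auto
    also have "\<dots> = lin ?w"
      by (rule lin_mult_cj_lin[OF c])
    finally have inv: "cj (lin ?w) = lin ?w" .
    \<comment> \<open>Strong induction: an even degree is covered by the hypothesis, and an odd one
      follows once all smaller positive degrees vanish. Every even positive degree below
      \<open>n\<close> is \<open>2 * l\<close> with \<open>l \<le> (n - 1) div 2\<close>.\<close>
    have zero: "?w i = \<zero>\<^bsub>R\<^esub>" if "0 < i" "i < n" for i
      using that
    proof (induction i rule: less_induct)
      case (less i)
      show ?case
      proof (cases "odd i")
        case True
        show ?thesis
          by (rule odd_coeff_zero[OF w inv less.prems(2) True]) (use less in simp)
      next
        case False
        then obtain l where "i = 2 * l" by (auto elim: evenE)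
        moreover have "l \<in> {1..(n - 1) div 2}"
          using less.prems calculation by auto
        ultimately show ?thesis using R by blast
      qed
    qed
    show "\<forall>i<n. ?w i = ?e i"
    proof (intro allI impI)
      fix i assume "i < n"
      then show "?w i = ?e i"
        using zero[of i] R w0 by (cases "i = 0") simp_all
    qed
  qed
  finally show ?thesis .
qed

lemma unitary_elements:
  "{v \<in> carrier A. v \<otimes>\<^bsub>A\<^esub> cj v = \<one>\<^bsub>A\<^esub>} =
    {(\<Oplus>\<^bsub>A\<^esub>i\<in>{0..n - 1}. c i \<odot>\<^bsub>A\<^esub> ((g \<ominus>\<^bsub>A\<^esub> \<one>\<^bsub>A\<^esub>) [^]\<^bsub>A\<^esub> i)) | c.
      c \<in> {0..n - 1} \<rightarrow> carrier R \<and>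
      (c 0 = \<one>\<^bsub>R\<^esub> \<or> c 0 = \<ominus>\<^bsub>R\<^esub> \<one>\<^bsub>R\<^esub>) \<and>
      (\<forall>i\<in>{1..(n - 1) div 2}.
        (\<Oplus>\<^bsub>R\<^esub>j\<in>{1..2 * i}. \<Oplus>\<^bsub>R\<^esub>k\<in>{0..j}.
           (\<ominus>\<^bsub>R\<^esub> \<one>\<^bsub>R\<^esub>) [^]\<^bsub>R\<^esub> k \<otimes>\<^bsub>R\<^esub> ([((n - k) choose (2 * i - j))] \<cdot>\<^bsub>R\<^esub> \<one>\<^bsub>R\<^esub>)
             \<otimes>\<^bsub>R\<^esub> c k \<otimes>\<^bsub>R\<^esub> c (j - k)) = \<zero>\<^bsub>R\<^esub>)}"
    (is "?L = {?s c | c. ?P c \<and> ?Q c \<and> ?S c}")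
proof -
  \<comment> \<open>Positivity of \<open>n\<close> is what makes the truncated \<open>n - 1\<close>
    the last index.\<close>
  have I: "{0..n - 1} = {..<n}"
    using n_pos by auto
  have s: "?s c = lin c" for c
    by (simp only: lin_def x_def I)
  have S: "?S c \<longleftrightarrow> (\<forall>i\<in>{1..(n - 1) div 2}. norm_coeff c (2 * i) = \<zero>\<^bsub>R\<^esub>)"
    if "c \<in> {..<n} \<rightarrow> carrier R" for c
    using norm_coeff_pos[OF that] by (intro ball_cong) (auto simp: norm_term_def)
  have *: "lin c \<otimes>\<^bsub>A\<^esub> cj (lin c) = \<one>\<^bsub>A\<^esub> \<longleftrightarrow> ?Q c \<and> ?S c" if "?P c" for c
    using that unitary_lin_iff[of c] S[of c] unfolding I by blast
  show ?thesis
    unfolding s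
  proof (intro equalityI subsetI)
    fix v assume v: "v \<in> ?L"
    then obtain c where "c \<in> {..<n} \<rightarrow> carrier R" "v = lin c"
      using lin_surj by blast
    then show "v \<in> {lin c | c. ?P c \<and> ?Q c \<and> ?S c}"
      using v * unfolding I by blast
  next
    fix v assume "v \<in> {lin c | c. ?P c \<and> ?Q c \<and> ?S c}"
    then show "v \<in> ?L"
      using * lin_closed unfolding I by blast
  qed
qed

end

section \<open>Galois groups of finite fields\<close>

text \<open>The nonzero elements form a group with one element less than the field; Lagrange's
  theorem and one further factor \<open>x\<close> give the claim, zero being checked
  separately.\<close>

lemma (in field) finite_field_pow_card:
  assumes fin: "finite (carrier R)" and x: "x \<in> carrier R"
  shows "x [^] card (carrier R) = x"
proof -
  have c: "card (carrier R) = Suc (card (Units R))"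
    using card_Suc_Diff1[OF fin zero_closed] by (simp only: field_Units)
  show ?thesis
  proof (cases "x = \<zero>")
    case True
    then show ?thesis by (simp add: c)
  next
    case False
    then have "x \<in> Units R" using x by (simp add: field_Units)
    then have "x [^] card (Units R) = \<one>"
      using fin by (intro units_power_order_eq_one) auto
    then show ?thesis using x by (simp add: c)
  qed
qed

text \<open>The additive group has order \<open>p ^ e\<close>, so the \<open>e\<close>-th power of
  \<open>[p] \<cdot> \<one>\<close>, which equals \<open>[p ^ e] \<cdot> \<one>\<close>, is zero. A
  domain has no nonzero nilpotent element.\<close>

lemma (in domain) finite_card_prime_power_char:
  assumes card: "card (carrier R) = p ^ e" and p: "p > 0"
  shows "[(p::nat)] \<cdot> \<one> = \<zero>"
proof -
  have pow: "[(p ^ k)] \<cdot> \<one> = ([p] \<cdot> \<one>) [^] (k::nat)" for k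
  proof (induction k)
    case (Suc k)
    have "[(p ^ Suc k)] \<cdot> \<one> = [p] \<cdot> ([(p ^ k)] \<cdot> \<one>)"
      by (simp add: add.nat_pow_pow mult.commute)
    also have "\<dots> = [p] \<cdot> \<one> \<otimes> [(p ^ k)] \<cdot> \<one>"
      by (simp add: add_pow_ldistr)
    finally show ?case
      by (simp add: Suc m_comm)
  qed simp
  have "finite (carrier R)"
    using card p by (intro card_ge_0_finite) simp
  then have "([p] \<cdot> \<one>) [^] e = \<zero>"
    using add.power_order_eq_one[of \<one>] by (simp add: card pow)
  then show ?thesis
    by (rule_tac ccontr) (induction e, auto simp: integral_iff)
qed

text \<open>The family \<open>e\<close> becomes a polynomial in \<open>UP R\<close>, nonzero because
  of \<open>e k\<close>, to which the bound of the number of roots by the degree applies.\<close>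

lemma (in domain) card_roots_le:
  assumes fin: "finite (carrier R)" and e: "e \<in> {..n::nat} \<rightarrow> carrier R"
    and k: "k \<le> n" "e k \<noteq> \<zero>"
  shows "card {y \<in> carrier R. (\<Oplus>i\<in>{..n}. e i \<otimes> y [^] i) = \<zero>} \<le> n"
proof -
  interpret U: UP_domain R "UP R" by unfold_locales
  \<comment> \<open>The values of \<open>e\<close> beyond \<open>n\<close> are arbitrary; cutting
    them off gives finite support and degree at most \<open>n\<close>.\<close>
  define f where "f = (\<lambda>i. if i \<le> n then e i else \<zero>)"
  have fc: "f i \<in> carrier R" for i
    using e by (auto simp: f_def)
  have "f \<in> up R"
    using fc by (intro mem_upI) (auto simp: f_def intro!: exI[of _ n] bound.intro)
  then have f: "f \<in> carrier (UP R)" and coeff: "coeff (UP R) f = f"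
    by (auto simp: UP_def)
  have nz: "f \<noteq> \<zero>\<^bsub>UP R\<^esub>"
  proof
    assume "f = \<zero>\<^bsub>UP R\<^esub>"
    then have "f k = \<zero>"
      by (simp add: UP_def)
    then show False
      using k by (simp add: f_def)
  qed
  have deg: "deg R f \<le> n"
    by (rule U.deg_aboveI) (auto simp: f coeff, simp add: f_def)
  have "(\<Oplus>i\<in>{..n}. e i \<otimes> y [^] i) = eval R R id y f" if y: "y \<in> carrier R" for y
  proof -
    have "eval R R id y f = (\<Oplus>i\<in>{..deg R f}. f i \<otimes> y [^] i)"
      using f by (simp add: U.eval_on_carrier coeff)
    also have "\<dots> = (\<Oplus>i\<in>{..n}. e i \<otimes> y [^] i)"
    proof (rule add.finprod_mono_neutral_cong_left)
      fix i assume "i \<in> {..n} - {..deg R f}"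
      then have "f i = \<zero>"
        using U.deg_aboveD[OF _ f, of i] coeff by auto
      then show "e i \<otimes> y [^] i = \<zero>"
        using \<open>i \<in> _\<close> y by (auto simp: f_def)
    qed (use deg e y in \<open>auto simp: f_def\<close>)
    finally show ?thesis by simp
  qed
  then have "{y \<in> carrier R. (\<Oplus>i\<in>{..n}. e i \<otimes> y [^] i) = \<zero>} =
      {y \<in> carrier R. eval R R id y f = \<zero>}"
    by auto
  then show ?thesis
    using U.roots_bound[OF f nz fin] deg by simp
qed

text \<open>A subgroup test inside the bijections of the carrier: the inverse of a bijective
  homomorphism is a homomorphism with the same fixed points.\<close>

lemma (in ring) group_galois_group:
  assumes K: "K \<subseteq> carrier R"
  shows "group (galois_group K R)"
proof -
  let ?B = "BijGroup (carrier R)"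
  let ?H = "{\<sigma> \<in> Bij (carrier R). \<sigma> \<in> ring_hom R R \<and> (\<forall>x\<in>K. \<sigma> x = x)}"
  have "subgroup ?H ?B"
  proof (rule group.subgroupI[OF group_BijGroup])
    show "?H \<subseteq> carrier ?B"
      by (auto simp: BijGroup_def)
    have "(\<lambda>x\<in>carrier R. x) \<in> ?H"
      using K by (auto simp: id_Bij intro!: ring_hom_memI)
    then show "?H \<noteq> {}"
      by blast
  next
    fix \<sigma> assume \<sigma>: "\<sigma> \<in> ?H"
    then have bij: "\<sigma> \<in> Bij (carrier R)" and hom: "\<sigma> \<in> ring_hom R R" and fix': "\<And>x. x \<in> K \<Longrightarrow> \<sigma> x = x"
      by auto
    have inj: "inj_on \<sigma> (carrier R)"
      using bij by (auto simp: Bij_def bij_betw_def)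
    have closed: "inv_into (carrier R) \<sigma> x \<in> carrier R" if "x \<in> carrier R" for x
      using bij that by (rule Bij_inv_into_mem)
    have fixed: "inv_into (carrier R) \<sigma> x = x" if "x \<in> carrier R" "\<sigma> x = x" for x
      using inv_into_f_f[OF inj that(1)] that(2) by simp
    have "restrict (inv_into (carrier R) \<sigma>) (carrier R) \<in> ring_hom R R"
    proof (rule ring_hom_memI)
      fix x y assume x: "x \<in> carrier R" and y: "y \<in> carrier R"
      show "restrict (inv_into (carrier R) \<sigma>) (carrier R) (x \<otimes> y) =
          restrict (inv_into (carrier R) \<sigma>) (carrier R) x \<otimes> restrict (inv_into (carrier R) \<sigma>) (carrier R) y"
        using Bij_inv_into_lemma[OF _ bij _ x y, of "(\<otimes>)"] hom x y by (auto simp: ring_hom_mult)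
      show "restrict (inv_into (carrier R) \<sigma>) (carrier R) (x \<oplus> y) =
          restrict (inv_into (carrier R) \<sigma>) (carrier R) x \<oplus> restrict (inv_into (carrier R) \<sigma>) (carrier R) y"
        using Bij_inv_into_lemma[OF _ bij _ x y, of "(\<oplus>)"] hom x y by (auto simp: ring_hom_add)
    qed (use closed fixed[of \<one>] ring_hom_one[OF hom] in auto)
    then show "inv\<^bsub>?B\<^esub> \<sigma> \<in> ?H"
      using bij fixed fix' K by (auto simp: inv_BijGroup restrict_inv_into_Bij)
  next
    fix \<sigma> \<tau> assume \<sigma>: "\<sigma> \<in> ?H" and \<tau>: "\<tau> \<in> ?H"
    have "compose (carrier R) \<sigma> \<tau> \<in> ring_hom R R"
      using \<sigma> \<tau> by (auto simp: compose_def ring_hom_def Pi_iff)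
    moreover have "compose (carrier R) \<sigma> \<tau> \<in> Bij (carrier R)"
      using \<sigma> \<tau> by (intro compose_Bij) auto
    ultimately show "\<sigma> \<otimes>\<^bsub>?B\<^esub> \<tau> \<in> ?H"
      using \<sigma> \<tau> K by (auto simp: BijGroup_def compose_eq)
  qed
  then show ?thesis
    unfolding galois_group_def by (rule subgroup.subgroup_is_group[OF _ group_BijGroup])
qed

lemma galois_group_mult:
  "\<sigma> \<in> carrier (galois_group K L) \<Longrightarrow> \<tau> \<in> carrier (galois_group K L) \<Longrightarrow>
    \<sigma> \<otimes>\<^bsub>galois_group K L\<^esub> \<tau> = compose (carrier L) \<sigma> \<tau>"
  by (simp add: galois_group_def BijGroup_def)

lemma galois_group_one: "\<one>\<^bsub>galois_group K L\<^esub> = (\<lambda>x\<in>carrier L. x)"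
  by (simp add: galois_group_def BijGroup_def)

lemma galois_group_memD:
  assumes "\<sigma> \<in> carrier (galois_group K L)"
  shows "\<sigma> \<in> ring_hom L L" "\<sigma> \<in> extensional (carrier L)" "x \<in> K \<Longrightarrow> \<sigma> x = x"
  using assms by (auto simp: galois_group_def Bij_def)

section \<open>The Frobenius automorphism and the cyclic Galois group\<close>

locale finite_field_extension = field L for L (structure) +
  fixes K and p q n s :: nat
  assumes subfield_K: "subfield K L" and prime_p: "prime p"
    and q_def: "q = p ^ s" and s_pos: "s > 0" and n_pos: "n > 0"
    and card_K: "card K = q" and card_L: "card (carrier L) = q ^ n"
begin

abbreviation G where "G \<equiv> galois_group K L"
abbreviation Frob where "Frob \<equiv> frobenius q L"

lemma q_gt_1: "q > 1"
  using one_less_power[OF prime_gt_1_nat[OF prime_p] s_pos] by (simp add: q_def)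

lemma finite_L: "finite (carrier L)"
  using card_L q_gt_1 by (intro card_ge_0_finite) simp

lemma K_subset: "K \<subseteq> carrier L"
  by (rule subfieldE(3)[OF subfield_K])

lemma char_L: "[p] \<cdot> \<one> = \<zero>"
  using prime_gt_0_nat[OF prime_p]
  by (intro finite_card_prime_power_char[of p "s * n"]) (simp_all add: card_L q_def power_mult)

lemma pow_q_n: "x \<in> carrier L \<Longrightarrow> x [^] (q ^ n) = x"
  using finite_field_pow_card[OF finite_L] by (simp add: card_L)

lemma pow_q_K:
  assumes "x \<in> K"
  shows "x [^] q = x"
proof -
  interpret F: field "L\<lparr>carrier := K\<rparr>"
    using subfield_iff(2)[OF subfield_K] .
  have "finite K"
    using finite_L K_subset by (rule rev_finite_subset)
  then show ?thesis
    using F.finite_field_pow_card[of x] assms by (simp add: card_K nat_pow_consistent[symmetric])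
qed

sublocale G: group G
  by (rule group_galois_group[OF K_subset])

text \<open>Additivity comes from characteristic \<open>p\<close>. Applying the power map
  \<open>n - 1\<close> further times gives the identity \<open>x^(q^n) = x\<close>, hence
  injectivity, and surjectivity by finiteness. Elements of \<open>K\<close> are fixed because
  \<open>K\<close> is a field with \<open>q\<close> elements.\<close>

lemma frobenius_closed: "Frob \<in> carrier G"
proof -
  have hom: "Frob \<in> ring_hom L L"
    using frobenius_power_add[OF prime_p char_L]
    by (intro ring_hom_memI) (auto simp: frobenius_def q_def nat_pow_distrib)
  have inj: "inj_on Frob (carrier L)"
  proof (rule inj_onI)
    fix x y assume x: "x \<in> carrier L" and y: "y \<in> carrier L" and "Frob x = Frob y"
    then have "(x [^] q) [^] (q ^ (n - 1)) = (y [^] q) [^] (q ^ (n - 1))"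
      by (simp add: frobenius_def)
    then have "x [^] (q ^ n) = y [^] (q ^ n)"
      using x y n_pos by (simp add: nat_pow_pow power_eq_if)
    then show "x = y"
      using x y by (simp add: pow_q_n)
  qed
  have "Frob ` carrier L \<subseteq> carrier L"
    by (auto simp: frobenius_def)
  then have "Frob ` carrier L = carrier L"
    using endo_inj_surj[OF finite_L _ inj] by blast
  then have "Frob \<in> Bij (carrier L)"
    using inj by (auto simp: Bij_def bij_betw_def frobenius_def)
  then show ?thesis
    using hom pow_q_K K_subset by (auto simp: galois_group_def frobenius_def)
qed

lemma frobenius_pow: "Frob [^]\<^bsub>G\<^esub> (i::nat) = (\<lambda>x\<in>carrier L. x [^] (q ^ i))"
proof (induction i)
  case 0
  show ?case
    by (auto simp: galois_group_one)
next
  case (Suc i)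
  have "Frob [^]\<^bsub>G\<^esub> Suc i = compose (carrier L) (Frob [^]\<^bsub>G\<^esub> i) Frob"
    by (simp add: galois_group_mult frobenius_closed)
  also have "\<dots> = (\<lambda>x\<in>carrier L. x [^] (q ^ Suc i))"
    unfolding Suc by (auto simp: compose_def frobenius_def nat_pow_pow)
  finally show ?case .
qed

lemma galois_group_cyclic:
  "inj_on (\<lambda>i. Frob [^]\<^bsub>G\<^esub> i) {..<n}" "carrier G = (\<lambda>i. Frob [^]\<^bsub>G\<^esub> i) ` {..<n}"
proof -
  obtain a where a: "a \<in> carrier (mult_of L)"
    and gen: "carrier (mult_of L) = {a [^] i | i::nat. i \<in> UNIV}"
    using finite_field_mult_group_has_gen[OF finite_L] by blast
  have aL: "a \<in> carrier L" using a by simp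
  let ?N = "q ^ n - 1"
  have card_mult: "card (carrier (mult_of L)) = ?N"
    using finite_L by (simp add: card_L)
  \<comment> \<open>The powers with exponents in \<open>{1..?N}\<close> already exhaust the
    \<open>?N\<close> nonzero elements, so they are distinct. This range contains every
    \<open>q ^ k\<close> with \<open>k < n\<close>.\<close>
  have inj_a: "inj_on (\<lambda>i. a [^] i) {1..?N}"
  proof (rule eq_card_imp_inj_on)
    have "a \<in> Units L" using a by (simp add: field_Units)
    moreover have "finite (Units L)" using finite_L by (simp add: field_Units)
    ultimately have aN: "a [^] ?N = \<one>"
      using units_power_order_eq_one[of a] card_mult by (simp add: field_Units)
    have "a [^] i \<in> (\<lambda>i. a [^] i) ` {1..?N}" for i :: nat
    proof
      \<comment> \<open>The residue of \<open>i\<close> modulo \<open>?N\<close> is taken in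
        \<open>{1..?N}\<close>, with \<open>?N\<close> representing zero.\<close>
      let ?r = "if i mod ?N = 0 then ?N else i mod ?N"
      have "a [^] i = a [^] (?N * (i div ?N) + i mod ?N)" by simp
      also have "\<dots> = (a [^] ?N) [^] (i div ?N) \<otimes> a [^] (i mod ?N)"
        using aL by (simp only: nat_pow_mult[symmetric] nat_pow_pow nat_pow_closed)
      also have "\<dots> = a [^] (i mod ?N)"
        using aL by (simp only: aN nat_pow_one l_one nat_pow_closed)
      also have "\<dots> = a [^] ?r"
        using aN by (simp del: One_nat_def)
      finally show "a [^] i = a [^] ?r" .
      have "?N > 0"
        using one_less_power[OF q_gt_1 n_pos] by simp
      then show "?r \<in> {1..?N}"
        using mod_less_divisor[of ?N i] by (auto simp del: mod_less_divisor)
    qed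
    then have "(\<lambda>i. a [^] i) ` {1..?N} = carrier (mult_of L)"
      unfolding gen by auto
    then show "card ((\<lambda>i. a [^] i) ` {1..?N}) = card {1..?N}"
      by (simp only: card_mult card_atLeastAtMost)
  qed simp
  show inj: "inj_on (\<lambda>i. Frob [^]\<^bsub>G\<^esub> i) {..<n}"
  proof (rule inj_onI)
    fix i j assume ij: "i \<in> {..<n}" "j \<in> {..<n}" and eq: "Frob [^]\<^bsub>G\<^esub> i = Frob [^]\<^bsub>G\<^esub> j"
    have range: "q ^ k \<in> {1..?N}" if "k < n" for k
    proof -
      have "q ^ k < q ^ n"
        using that q_gt_1 by (intro power_strict_increasing)
      moreover have "q ^ k > 0"
        using q_gt_1 by simp
      ultimately show ?thesis by auto
    qed
    have "a [^] (q ^ i) = a [^] (q ^ j)"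
      using fun_cong[OF eq, of a] aL by (simp add: frobenius_pow)
    then have "q ^ i = q ^ j"
      using ij range by (intro inj_onD[OF inj_a]) auto
    then show "i = j"
      using q_gt_1 by simp
  qed
  have K_sub: "subring K L"
    by (rule subfieldE(1)[OF subfield_K])
  text \<open>There are more coefficient vectors than values, so two polynomials over \<open>K\<close> of
    degree at most \<open>n\<close> agree at \<open>a\<close>.\<close>
  let ?E = "{..n} \<rightarrow>\<^sub>E K"
  let ?v = "\<lambda>c. \<Oplus>i\<in>{..n}. c i \<otimes> a [^] i"
  have "\<not> inj_on ?v ?E"
  proof
    assume "inj_on ?v ?E"
    moreover have "?v ` ?E \<subseteq> carrier L"
      using aL K_subset by (auto intro!: finsum_closed)
    ultimately have "card ?E \<le> card (carrier L)"
      using finite_L by (intro card_inj_on_le)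
    then show False
      using q_gt_1 by (simp add: card_PiE card_K card_L)
  qed
  then obtain c d where c: "c \<in> ?E" and d: "d \<in> ?E" and "c \<noteq> d" and vcd: "?v c = ?v d"
    by (auto simp: inj_on_def)
  then obtain k where k: "k \<le> n" "c k \<noteq> d k"
    using PiE_ext[of c "{..n}" "\<lambda>_. K" d] by auto
  \<comment> \<open>The difference of the two polynomials has coefficients in \<open>K\<close>,
    vanishes at \<open>a\<close>, and is nonzero at index \<open>k\<close>.\<close>
  define e where "e i = c i \<ominus> d i" for i
  have cL: "c i \<in> carrier L" and dL: "d i \<in> carrier L" and eK: "e i \<in> K" if "i \<le> n" for i
  proof -
    have "c i \<in> K" "d i \<in> K" using c d that by auto
    then show "c i \<in> carrier L" "d i \<in> carrier L" "e i \<in> K"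
      using K_subset K_sub by (auto simp: e_def a_minus_def intro!: subringE(5,7))
  qed
  have eL: "e i \<in> carrier L" if "i \<le> n" for i
    using eK[OF that] K_subset by blast
  have "?v e \<oplus> ?v d = (\<Oplus>i\<in>{..n}. e i \<otimes> a [^] i \<oplus> d i \<otimes> a [^] i)"
    using aL by (intro finsum_addf[symmetric]) (auto simp: eL dL)
  also have "\<dots> = ?v c"
  proof (rule finsum_cong')
    fix i assume "i \<in> {..n}"
    then have "c i = e i \<oplus> d i"
      using cL[of i] dL[of i] by (simp add: e_def a_minus_def a_assoc l_neg)
    then show "e i \<otimes> a [^] i \<oplus> d i \<otimes> a [^] i = c i \<otimes> a [^] i"
      using \<open>i \<in> _\<close> aL by (simp add: l_distr eL dL)
  qed (use aL cL in auto)
  also have "\<dots> = \<zero> \<oplus> ?v d"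
    using aL dL by (simp add: vcd)
  finally have ve: "?v e = \<zero>"
    using aL by (subst (asm) add.right_cancel) (auto simp: eL dL intro!: finsum_closed)
  have ek: "e k \<noteq> \<zero>"
    using k cL dL by (simp add: e_def)
  let ?Z = "{y \<in> carrier L. (\<Oplus>i\<in>{..n}. e i \<otimes> y [^] i) = \<zero>}"
  \<comment> \<open>An automorphism fixes the coefficients \<open>e i\<close>, which lie in
    \<open>K\<close>, so it maps the root \<open>a\<close> to a root.\<close>
  have sub: "(\<lambda>\<sigma>. \<sigma> a) ` carrier G \<subseteq> ?Z"
  proof clarify
    fix \<sigma> assume "\<sigma> \<in> carrier G"
    note \<sigma> = galois_group_memD[OF this]
    interpret h: ring_hom_cring L L \<sigma>
      by unfold_locales (rule \<sigma>(1))
    have "\<zero> = \<sigma> (?v e)"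
      by (simp add: ve)
    also have "\<dots> = (\<Oplus>i\<in>{..n}. \<sigma> (e i \<otimes> a [^] i))"
      using aL by (subst h.hom_finsum) (auto simp: eL comp_def)
    also have "\<dots> = (\<Oplus>i\<in>{..n}. e i \<otimes> \<sigma> a [^] i)"
      using aL by (intro finsum_cong') (auto simp: eL eK \<sigma>(3) h.hom_nat_pow)
    finally show "\<sigma> a \<in> carrier L \<and> (\<Oplus>i\<in>{..n}. e i \<otimes> \<sigma> a [^] i) = \<zero>"
      using aL by simp
  qed
  \<comment> \<open>Every nonzero element is a power of \<open>a\<close>, so the value at
    \<open>a\<close> determines a homomorphism.\<close>
  have inj_eval: "inj_on (\<lambda>\<sigma>. \<sigma> a) (carrier G)"
  proof (rule inj_onI)
    fix \<sigma> \<tau> assume "\<sigma> \<in> carrier G" "\<tau> \<in> carrier G" and eq: "\<sigma> a = \<tau> a"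
    note \<sigma> = galois_group_memD[OF this(1)] and \<tau> = galois_group_memD[OF this(2)]
    interpret h: ring_hom_cring L L \<sigma>
      by unfold_locales (rule \<sigma>(1))
    interpret h': ring_hom_cring L L \<tau>
      by unfold_locales (rule \<tau>(1))
    show "\<sigma> = \<tau>"
    proof (rule extensionalityI[OF \<sigma>(2) \<tau>(2)])
      fix x assume x: "x \<in> carrier L"
      show "\<sigma> x = \<tau> x"
      proof (cases "x = \<zero>")
        case False
        then obtain i :: nat where "x = a [^] i"
          using x gen by auto
        then show ?thesis
          using aL eq by (simp add: h.hom_nat_pow h'.hom_nat_pow)
      qed simp
    qed
  qed
  have finZ: "finite ?Z" using finite_L by simp
  \<comment> \<open>The group has at most \<open>n\<close> elements, and the Frobenius powers are
    already \<open>n\<close> distinct ones, so they exhaust it.\<close>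
  have "card (carrier G) \<le> card ?Z"
    using inj_eval sub finZ by (rule card_inj_on_le)
  also have "card ?Z \<le> n"
    using k(1) ek by (intro card_roots_le[OF finite_L]) (auto simp: eL)
  also have "n = card ((\<lambda>i. Frob [^]\<^bsub>G\<^esub> i) ` {..<n})"
    using inj by (simp add: card_image)
  finally show "carrier G = (\<lambda>i. Frob [^]\<^bsub>G\<^esub> i) ` {..<n}"
    using inj_on_finite[OF inj_eval sub finZ] frobenius_closed
    by (intro card_seteq[symmetric]) auto
qed

end

section \<open>The group algebra of the Galois group over the small field\<close>

theorem theorem2p6:
  fixes L :: "('a, 'm) ring_scheme" and K :: "'a set" and p q n :: nat
  assumes "prime p" and "odd p"
    and "\<exists>s>0. q = p ^ s" and "\<exists>m. n = p ^ m"
    and "field L" and "subfield K L"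
    and "card K = q" and "card (carrier L) = q ^ n"
  defines "F \<equiv> L\<lparr>carrier := K\<rparr>"
    and "G \<equiv> galois_group K L"
    and "A \<equiv> group_algebra (L\<lparr>carrier := K\<rparr>) (galois_group K L)"
    and "\<phi> \<equiv> group_element (L\<lparr>carrier := K\<rparr>) (galois_group K L) (frobenius q L)"
  shows "{v \<in> carrier A. v \<otimes>\<^bsub>A\<^esub> conjugation G v = \<one>\<^bsub>A\<^esub>} =
    {(\<Oplus>\<^bsub>A\<^esub>i\<in>{0..n - 1}. c i \<odot>\<^bsub>A\<^esub> ((\<phi> \<ominus>\<^bsub>A\<^esub> \<one>\<^bsub>A\<^esub>) [^]\<^bsub>A\<^esub> i)) | c :: nat \<Rightarrow> 'a.
      c \<in> {0..n - 1} \<rightarrow> carrier F \<and>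
      (c 0 = \<one>\<^bsub>F\<^esub> \<or> c 0 = \<ominus>\<^bsub>F\<^esub> \<one>\<^bsub>F\<^esub>) \<and>
      (\<forall>i\<in>{1..(n - 1) div 2}.
        (\<Oplus>\<^bsub>F\<^esub>j\<in>{1..2 * i}. \<Oplus>\<^bsub>F\<^esub>k\<in>{0..j}.
           (\<ominus>\<^bsub>F\<^esub> \<one>\<^bsub>F\<^esub>) [^]\<^bsub>F\<^esub> k \<otimes>\<^bsub>F\<^esub> ([((n - k) choose (2 * i - j))] \<cdot>\<^bsub>F\<^esub> \<one>\<^bsub>F\<^esub>)
             \<otimes>\<^bsub>F\<^esub> c k \<otimes>\<^bsub>F\<^esub> c (j - k)) = \<zero>\<^bsub>F\<^esub>)}"
proof -
  obtain s m where s: "s > 0" "q = p ^ s" and m: "n = p ^ m"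
    using assms(3,4) by blast
  have n_pos: "n > 0"
    using m prime_gt_0_nat[OF assms(1)] by simp
  interpret L: finite_field_extension L K p q n s
    using assms s n_pos
    by (intro finite_field_extension.intro finite_field_extension_axioms.intro) auto
  interpret F: field F
    unfolding F_def using L.subfield_iff(2)[OF L.subfield_K] .
  define f where "f = frobenius q L"
  have f: "f \<in> carrier G"
    and inj: "inj_on (\<lambda>i. f [^]\<^bsub>G\<^esub> i) {..<n}"
    and gen: "carrier G = (\<lambda>i. f [^]\<^bsub>G\<^esub> i) ` {..<n}"
    using L.frobenius_closed L.galois_group_cyclic by (simp_all add: f_def G_def)
  interpret G: group G
    unfolding G_def by (rule L.G.is_group)
  \<comment> \<open>All elements are powers of \<open>f\<close>, and these commute with each
    other.\<close>
  have comm: "comm_group G"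
    by (rule G.group_comm_groupI) (use f in \<open>auto simp: gen G.nat_pow_mult add.commute\<close>)
  have card_G: "card (carrier G) = n"
    unfolding gen using inj by (simp add: card_image)
  have finite_G: "finite (carrier G)"
    unfolding gen by simp
  interpret FG: finite_group_algebra F G
    by (intro finite_group_algebra.intro finite_group_algebra_axioms.intro comm finite_G F.is_cring)
  have A: "A = group_algebra F G" and \<phi>: "\<phi> = group_element F G f"
    by (simp_all add: A_def \<phi>_def F_def G_def f_def)
  have card_F: "card (carrier F) = q"
    by (simp add: F_def assms(7))
  have "f [^]\<^bsub>G\<^esub> n = \<one>\<^bsub>G\<^esub>"
    using G.pow_order_eq_1[OF f] by (simp add: order_def card_G)
  then have f_n: "\<phi> [^]\<^bsub>A\<^esub> n = \<one>\<^bsub>A\<^esub>"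
    using FG.group_element_pow[OF f, of n] by (simp add: A \<phi> group_algebra_simps(1))
  \<comment> \<open>Spanning comes from the expansion in powers of the generator. The cardinality
    holds because the algebra consists of all functions from a group of order \<open>n\<close> to
    \<open>F\<close>.\<close>
  interpret C: cyclic_p_algebra F A p m n \<phi> "conjugation G"
  proof (unfold A \<phi>, intro cyclic_p_algebra.intro cyclic_p_algebra_axioms.intro)
    show "algebra F (group_algebra F G)" ..
    show "domain F" ..
    show "cring (group_algebra F G)" ..
    show "[p] \<cdot>\<^bsub>F\<^esub> \<one>\<^bsub>F\<^esub> = \<zero>\<^bsub>F\<^esub>"
      using prime_gt_0_nat[OF assms(1)] s(2)
      by (intro F.finite_card_prime_power_char[of p s]) (simp_all add: card_F)
    show "finite (carrier F)"
      using L.finite_L L.K_subset by (auto simp: F_def intro: finite_subset)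
    show "group_element F G f [^]\<^bsub>group_algebra F G\<^esub> n = \<one>\<^bsub>group_algebra F G\<^esub>"
      using f_n by (simp add: A \<phi>)
    show "card (carrier (group_algebra F G)) = card (carrier F) ^ n"
      by (simp add: carrier_group_algebra finite_G card_PiE card_G)
    show "\<exists>c\<in>{..<n} \<rightarrow> carrier F. u = (\<Oplus>\<^bsub>group_algebra F G\<^esub>i\<in>{..<n}.
        c i \<odot>\<^bsub>group_algebra F G\<^esub> group_element F G f [^]\<^bsub>group_algebra F G\<^esub> i)"
      if "u \<in> carrier (group_algebra F G)" for u
      using FG.group_algebra_expand[OF f inj gen that] f FG.A_closed[OF that]
      by (intro bexI[of _ "\<lambda>i. u (f [^]\<^bsub>G\<^esub> i)"]) auto
    show "conjugation G (group_element F G f) \<otimes>\<^bsub>group_algebra F G\<^esub> group_element F G f =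
        \<one>\<^bsub>group_algebra F G\<^esub>"
      using f by (simp add: conjugation_group_element[OF G.is_group] FG.group_element_mult
          group_algebra_simps(1))
  qed (use assms(1,2) m in \<open>auto simp: FG.group_element_closed FG.conjugation_conjugation
      FG.conjugation_smult FG.conjugation_ring_hom\<close>)
  show ?thesis
    by (rule C.unitary_elements)
qed

end
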